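(* Let $\Delta$ be a field, let $G$ be a free group of rank at least $2$, totally ordered by the dictionary (Magnus) order, and let $D=\Delta((G))$ be the Mal'cev-Neumann division ring of $G$ over $\Delta$ (with respect to the trivial morphism $G\to\mathrm{Aut}(\Delta)$). Then every maximal subfield of $D$ is self-invariant.
   Context: Mal'cev-Neumann division ring: for a totally ordered group $G$ (a group with a total order such that $a\preceq b$ implies $ac\preceq bc$ and $ca\preceq cb$) and a field $\Delta$, $\Delta((G))$ is the set of formal sums $\alpha=\sum_{g\in G}a_g g$ with $a_g\in\Delta$ whose support $\mathrm{supp}(\alpha)=\{g\in G: a_g\neq 0\}$ is well-ordered (every non-empty subset has a least element). Addition is componentwise and multiplication is $\big(\sum_g a_g g\big)\big(\sum_h b_h h\big)=\sum_{t\in G}\big(\sum_{gh=t}a_g b_h\big)t$. This is a division ring. Order on the free group: let $G$ be free on a set $X=\{x_i\}$, and fix a total order on $X$. Embed $G$ in the group of units of the ring of formal power series over $\mathbb{Z}$ in non-commuting indeterminates $t_i$ via $x_i\mapsto 1+t_i$. Order monomials first by degree and then lexicographically, and declare $g<h$ if the coefficient of the least monomial appearing in (the image of $h$) $-$ (the image of $g$) is positive. This makes $G$ a totally ordered group. A maximal subfield of a division ring $D$ with center $F$ is a field $K\subseteq D$ containing $F$ with $C_D(K)=K$, where $C_D(K)$ is the centralizer of $K$ in $D$. A subfield $K$ of $D$ is self-invariant if $N_{D^*}(K^* )\cup\{0\}=K$, where $D^*=D\setminus\{0\}$, $K^*=K\setminus\{0\}$, and $N_{D^*}(A)=\{b\in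 D^*: bAb^{-1}\subseteq A\}$. *)

theory Defs
  imports "HOL-Algebra.Subrings"
begin

section \<open>Free groups\<close>

text \<open>The letter \<open>(x, True)\<close> stands for \<open>x\<close> and \<open>(x, False)\<close> for its formal inverse.\<close>

type_synonym 'x letter = "'x \<times> bool"

definition inv_letter :: "'x letter \<Rightarrow> 'x letter" where
  "inv_letter a = (fst a, \<not> snd a)"

definition reduced :: "'x letter list \<Rightarrow> bool" where
  "reduced w \<longleftrightarrow> successively (\<lambda>a b. b \<noteq> inv_letter a) w"

fun cons_reduce :: "'x letter \<Rightarrow> 'x letter list \<Rightarrow> 'x letter list" where
  "cons_reduce a [] = [a]"
| "cons_reduce a (b # w) = (if b = inv_letter a then w else a # b # w)"

definition free_group :: "'x set \<Rightarrow> 'x letter list monoid" where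
  "free_group X =
    \<lparr>carrier = {w \<in> lists (X \<times> UNIV). reduced w},
     mult = \<lambda>u v. foldr cons_reduce u v,
     one = []\<rparr>"


section \<open>The Magnus order\<close>

text \<open>Integral formal power series in the non-commuting indeterminates \<open>t x\<close> for \<open>x \<in> X\<close>.
  A monomial is a list of elements of \<open>X\<close>, a series is its coefficient function.\<close>

definition nc_series :: "'x set \<Rightarrow> ('x list \<Rightarrow> int) ring" where
  "nc_series X =
    \<lparr>carrier = {f. \<forall>w. f w \<noteq> 0 \<longrightarrow> w \<in> lists X},
     mult = \<lambda>f g w. \<Sum>i\<le>length w. f (take i w) * g (drop i w),
     one = \<lambda>w. if w = [] then 1 else 0,
     zero = \<lambda>w. 0,
     add = \<lambda>f g w. f w + g w\<rparr>"

definition indet :: "'x \<Rightarrow> 'x list \<Rightarrow> int" where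
  "indet x = (\<lambda>w. if w = [x] then 1 else 0)"

definition magnus_letter :: "'x set \<Rightarrow> 'x letter \<Rightarrow> 'x list \<Rightarrow> int" where
  "magnus_letter X a =
    (let u = \<one>\<^bsub>nc_series X\<^esub> \<oplus>\<^bsub>nc_series X\<^esub> indet (fst a)
     in if snd a then u else inv\<^bsub>nc_series X\<^esub> u)"

definition magnus :: "'x set \<Rightarrow> 'x letter list \<Rightarrow> 'x list \<Rightarrow> int" where
  "magnus X w =
    foldr (\<lambda>a f. magnus_letter X a \<otimes>\<^bsub>nc_series X\<^esub> f) w \<one>\<^bsub>nc_series X\<^esub>"

text \<open>Here \<open>r\<close> is the (reflexive) total order on \<open>X\<close>, so that \<open>lenlex (r - Id)\<close> orders
  monomials first by degree and then lexicographically.\<close>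

definition magnus_less :: "'x set \<Rightarrow> 'x rel \<Rightarrow> 'x letter list \<Rightarrow> 'x letter list \<Rightarrow> bool" where
  "magnus_less X r g h \<longleftrightarrow>
    (\<exists>m. magnus X h m - magnus X g m > 0 \<and>
         (\<forall>m'. magnus X h m' - magnus X g m' \<noteq> 0 \<longrightarrow> m' = m \<or> (m, m') \<in> lenlex (r - Id)))"

definition magnus_order :: "'x set \<Rightarrow> 'x rel \<Rightarrow> 'x letter list rel" where
  "magnus_order X r =
    {(g, h). g \<in> carrier (free_group X) \<and> h \<in> carrier (free_group X) \<and>
             (g = h \<or> magnus_less X r g h)}"


section \<open>Mal'cev--Neumann rings\<close>

definition supp :: "('g \<Rightarrow> 'k::zero) \<Rightarrow> 'g set" where
  "supp \<alpha> = {g. \<alpha> g \<noteq> 0}"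

definition well_ordered_in :: "'g rel \<Rightarrow> 'g set \<Rightarrow> bool" where
  "well_ordered_in ord S \<longleftrightarrow> (\<forall>T\<subseteq>S. T \<noteq> {} \<longrightarrow> (\<exists>m\<in>T. \<forall>t\<in>T. (m, t) \<in> ord))"

text \<open>The sum in the product ranges over the pairs that contribute a nonzero term. If \<open>ord\<close>
  is a bi-invariant total order on \<open>G\<close>, there are only finitely many of them.\<close>

definition malcev_neumann :: "('g, 'b) monoid_scheme \<Rightarrow> 'g rel \<Rightarrow> ('g \<Rightarrow> 'k::field) ring" where
  "malcev_neumann G ord =
    \<lparr>carrier = {\<alpha>. supp \<alpha> \<subseteq> carrier G \<and> well_ordered_in ord (supp \<alpha>)},
     mult = \<lambda>\<alpha> \<beta> t.
       \<Sum>(g, h)\<in>{(g, h). g \<in> supp \<alpha> \<and> h \<in> supp \<beta> \<and> g \<otimes>\<^bsub>G\<^esub> h = t}. \<alpha> g * \<beta> h,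
     one = \<lambda>g. if g = \<one>\<^bsub>G\<^esub> then 1 else 0,
     zero = \<lambda>g. 0,
     add = \<lambda>\<alpha> \<beta> g. \<alpha> g + \<beta> g\<rparr>"


section \<open>Maximal and self-invariant subfields\<close>

definition centralizer :: "('a, 'b) ring_scheme \<Rightarrow> 'a set \<Rightarrow> 'a set" where
  "centralizer D S = {d \<in> carrier D. \<forall>s\<in>S. d \<otimes>\<^bsub>D\<^esub> s = s \<otimes>\<^bsub>D\<^esub> d}"

definition center :: "('a, 'b) ring_scheme \<Rightarrow> 'a set" where
  "center D = centralizer D (carrier D)"

definition maximal_subfield :: "('a, 'b) ring_scheme \<Rightarrow> 'a set \<Rightarrow> bool" where
  "maximal_subfield D K \<longleftrightarrow> subfield K D \<and> center D \<subseteq> K \<and> centralizer D K = K"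

text \<open>Only the inclusion \<open>b A b\<^sup>-\<^sup>1 \<subseteq> A\<close> is required, unlike for the library's
  \<open>normalizer\<close>, which asks for equality.\<close>

definition unit_normalizer :: "('a, 'b) ring_scheme \<Rightarrow> 'a set \<Rightarrow> 'a set" where
  "unit_normalizer D A =
    {b \<in> carrier D - {\<zero>\<^bsub>D\<^esub>}. (\<lambda>a. b \<otimes>\<^bsub>D\<^esub> a \<otimes>\<^bsub>D\<^esub> inv\<^bsub>D\<^esub> b) ` A \<subseteq> A}"

definition self_invariant :: "('a, 'b) ring_scheme \<Rightarrow> 'a set \<Rightarrow> bool" where
  "self_invariant D K \<longleftrightarrow> unit_normalizer D (K - {\<zero>\<^bsub>D\<^esub>}) \<union> {\<zero>\<^bsub>D\<^esub>} = K"

end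

theory Submission
  imports Defs "HOL-Library.Function_Algebras" "HOL-Library.Sublist"
begin

text \<open>
  The value of a nonzero series is the least element of its support; it is multiplicative, and
  commuting series have commuting values. Let \<open>K\<close> be a maximal subfield and let \<open>b \<noteq> 0\<close> satisfy
  \<open>b K\<^sup>* b\<^sup>-\<^sup>1 \<subseteq> K\<^sup>*\<close>. Since \<open>K\<close> is its own centralizer, it suffices that \<open>b\<close> commutes with every
  \<open>t \<in> K\<close>. The scalars are central, so the coefficient of \<open>t\<close> at the neutral element may be
  subtracted; so \<open>t\<close> may be assumed to be nonzero with value \<open>z \<noteq> 1\<close>.

  Let \<open>h\<close> be the value of \<open>b\<close> and put \<open>s = b t b\<^sup>-\<^sup>1\<close>. Both \<open>s\<close> and \<open>t\<close> lie in the commutative \<open>K\<close>,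
  so the value \<open>h z h\<^sup>-\<^sup>1\<close> of \<open>s\<close> commutes with \<open>z\<close>. In a free group this forces \<open>h\<close> to commute
  with \<open>z\<close> (\<open>conjugates_commute_only_if_equal\<close>). Now \<open>b t - t b = (s - t) b\<close>. If this is not zero,
  then its value is the product of the value of \<open>s - t\<close>, which commutes with \<open>z\<close> because
  \<open>s - t \<in> K\<close>, and of \<open>h\<close>; hence the value of the commutator centralizes \<open>z\<close>. That is
  impossible: a nonzero commutator with \<open>t\<close> never has a value in the centralizer \<open>C\<close> of \<open>z\<close>
  (\<open>leads_commutator_not_in_cent\<close>).

  The last claim is obvious if the support of \<open>t\<close> lies in the abelian group \<open>C\<close>: then the part of
  \<open>b\<close> supported in \<open>C\<close> commutes with \<open>t\<close>, while the remaining part contributes only terms outside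
  \<open>C\<close>. The general case reduces to this one, because \<open>t\<close> is conjugate to a series supported in \<open>C\<close>,
  by a series with value \<open>1\<close> (\<open>conjugate_into_centralizer\<close>). The conjugating series solves an
  equation that can be improved one term at a time, and the ring is spherically complete, so
  Zorn's lemma yields a solution (\<open>successive_approximation\<close>). The same principle produces
  multiplicative inverses. This argument works over any ordered group with the two properties of
  centralizers that are assumed in \<open>maximal_subfield_self_invariant\<close>.

  For the free group both properties rest on the fact that commuting elements have a common power
  (\<open>commuting_elements_have_common_power\<close>): after conjugation one of them is cyclically reduced,
  the other can then be multiplied without cancellation by it or by its inverse, and two words
  that commute under concatenation are powers of one word. Centralizers are abelian because in an
  ordered group an element commutes with \<open>g\<close> as soon as it commutes with a positive power of \<open>g\<close>.
  If \<open>h z h\<^sup>-\<^sup>1\<close> commutes with \<open>z\<close>, then \<open>(h z h\<^sup>-\<^sup>1)\<^sup>m = z\<^sup>n\<close>, and comparing the lowest coefficients of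
  the Magnus expansions gives \<open>m = n\<close>; hence \<open>h z h\<^sup>-\<^sup>1 = z\<close>. That the Magnus order is a total order
  at all needs the injectivity of the Magnus expansion (\<open>magnus_inj\<close>).
\<close>

section \<open>Ordered groups and their well-ordered subsets\<close>

lemma (in group) pow_conjugate:
  assumes g: "g \<in> carrier G" and h: "h \<in> carrier G"
  shows "(g \<otimes> h \<otimes> inv g) [^] (k::nat) = g \<otimes> h [^] k \<otimes> inv g"
proof (induction k)
  case (Suc k)
  have "(g \<otimes> h \<otimes> inv g) [^] Suc k = (g \<otimes> h [^] k \<otimes> inv g) \<otimes> (g \<otimes> h \<otimes> inv g)"
    by (simp only: nat_pow_Suc Suc)
  also have "\<dots> = g \<otimes> h [^] k \<otimes> (inv g \<otimes> g) \<otimes> h \<otimes> inv g"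
    using g h by (simp only: m_assoc m_closed inv_closed nat_pow_closed)
  finally have "(g \<otimes> h \<otimes> inv g) [^] Suc k = g \<otimes> h [^] k \<otimes> (inv g \<otimes> g) \<otimes> h \<otimes> inv g" .
  then show ?case using g h by (simp add: m_assoc)
qed (use g in simp)

locale ordered_group = group G for G (structure) +
  fixes ord :: "'a rel"
  assumes linear_ord: "linear_order_on (carrier G) ord"
    and ord_mult_right: "\<lbrakk>(a, b) \<in> ord; c \<in> carrier G\<rbrakk> \<Longrightarrow> (a \<otimes> c, b \<otimes> c) \<in> ord"
    and ord_mult_left: "\<lbrakk>(a, b) \<in> ord; c \<in> carrier G\<rbrakk> \<Longrightarrow> (c \<otimes> a, c \<otimes> b) \<in> ord"
begin

abbreviation le (infix "\<preceq>" 50) where "a \<preceq> b \<equiv> (a, b) \<in> ord"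
definition lt (infix "\<prec>" 50) where "a \<prec> b \<longleftrightarrow> a \<preceq> b \<and> a \<noteq> b"

lemma le_carrier: "a \<preceq> b \<Longrightarrow> a \<in> carrier G" "a \<preceq> b \<Longrightarrow> b \<in> carrier G"
  using linear_ord by (auto simp: order_on_defs)

lemma lt_carrier: "a \<prec> b \<Longrightarrow> a \<in> carrier G" "a \<prec> b \<Longrightarrow> b \<in> carrier G"
  by (auto simp: lt_def le_carrier)

lemma le_refl [simp]: "a \<in> carrier G \<Longrightarrow> a \<preceq> a"
  using linear_ord by (auto simp: order_on_defs refl_on_def)

lemma le_antisym: "a \<preceq> b \<Longrightarrow> b \<preceq> a \<Longrightarrow> a = b"
  using linear_ord by (auto simp: order_on_defs dest: antisymD)

lemma le_trans: "a \<preceq> b \<Longrightarrow> b \<preceq> c \<Longrightarrow> a \<preceq> c"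
  using linear_ord by (auto simp: order_on_defs dest: transD)

lemma lt_irrefl [simp]: "\<not> a \<prec> a"
  by (simp add: lt_def)

lemma le_lt_trans: "a \<preceq> b \<Longrightarrow> b \<prec> c \<Longrightarrow> a \<prec> c"
  by (metis lt_def le_trans le_antisym)

lemma lt_le_trans: "a \<prec> b \<Longrightarrow> b \<preceq> c \<Longrightarrow> a \<prec> c"
  by (metis lt_def le_trans le_antisym)

lemma lt_trans: "a \<prec> b \<Longrightarrow> b \<prec> c \<Longrightarrow> a \<prec> c"
  by (metis lt_def le_lt_trans)

lemma lt_imp_le: "a \<prec> b \<Longrightarrow> a \<preceq> b"
  by (simp add: lt_def)

lemma le_or_lt: "a \<in> carrier G \<Longrightarrow> b \<in> carrier G \<Longrightarrow> a \<preceq> b \<or> b \<prec> a"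
  using linear_ord by (cases "a = b") (auto simp: order_on_defs total_on_def lt_def)

lemma not_le_iff: "a \<in> carrier G \<Longrightarrow> b \<in> carrier G \<Longrightarrow> \<not> a \<preceq> b \<longleftrightarrow> b \<prec> a"
  by (metis le_or_lt le_lt_trans lt_irrefl)

lemma lt_mult_right: "a \<prec> b \<Longrightarrow> c \<in> carrier G \<Longrightarrow> a \<otimes> c \<prec> b \<otimes> c"
  using ord_mult_right[of a b c] lt_carrier[of a b] by (auto simp: lt_def)

lemma lt_mult_left: "a \<prec> b \<Longrightarrow> c \<in> carrier G \<Longrightarrow> c \<otimes> a \<prec> c \<otimes> b"
  using ord_mult_left[of a b c] lt_carrier[of a b] by (auto simp: lt_def Units_eq)

lemma mult_mono_le: "a \<preceq> b \<Longrightarrow> c \<preceq> d \<Longrightarrow> a \<otimes> c \<preceq> b \<otimes> d"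
  by (metis le_trans ord_mult_left ord_mult_right le_carrier)

lemma mult_lt_le: "a \<prec> b \<Longrightarrow> c \<preceq> d \<Longrightarrow> a \<otimes> c \<prec> b \<otimes> d"
  by (metis lt_le_trans lt_mult_right ord_mult_left le_carrier lt_carrier)

lemma mult_le_lt: "a \<preceq> b \<Longrightarrow> c \<prec> d \<Longrightarrow> a \<otimes> c \<prec> b \<otimes> d"
  by (metis le_lt_trans lt_mult_left ord_mult_right le_carrier lt_carrier)

lemma nat_pow_strict_mono:
  assumes "a \<prec> b" "n > 0"
  shows "a [^] (n::nat) \<prec> b [^] n"
proof -
  have "a [^] Suc k \<prec> b [^] Suc k" for k
    by (induction k) (use assms(1) in \<open>auto simp: lt_carrier intro: mult_lt_le lt_imp_le\<close>)
  then show ?thesis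
    using assms(2) by (metis gr0_implies_Suc)
qed

lemma nat_pow_cancel:
  assumes "a \<in> carrier G" "b \<in> carrier G" "a [^] (n::nat) = b [^] n" "n > 0"
  shows "a = b"
  using assms nat_pow_strict_mono[of a b n] nat_pow_strict_mono[of b a n] le_or_lt[of a b]
  by (metis lt_def lt_irrefl)

text \<open>Conjugating \<open>h\<close> by \<open>g\<close> gives an element with the same \<open>n\<close>-th power, and
  taking powers is injective in an ordered group.\<close>

lemma commute_if_pow_commutes:
  assumes g: "g \<in> carrier G" and h: "h \<in> carrier G" and n: "n > 0"
    and comm: "g \<otimes> h [^] (n::nat) = h [^] n \<otimes> g"
  shows "g \<otimes> h = h \<otimes> g"
proof -
  have "(g \<otimes> h \<otimes> inv g) [^] n = h [^] n"
    unfolding pow_conjugate[OF g h] comm using g h by (simp add: m_assoc)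
  from nat_pow_cancel[OF _ h this n] have "g \<otimes> h \<otimes> inv g = h"
    using g h by blast
  then show ?thesis
    by (metis inv_solve_right'[of h "g \<otimes> h" g] m_closed g h)
qed

text \<open>These are the sets that may occur as supports.\<close>

definition wos :: "'a set \<Rightarrow> bool" where
  "wos S \<longleftrightarrow> S \<subseteq> carrier G \<and> well_ordered_in ord S"

lemma wosD: "wos S \<Longrightarrow> x \<in> S \<Longrightarrow> x \<in> carrier G"
  by (auto simp: wos_def)

lemma wos_least:
  assumes "wos S" "T \<subseteq> S" "T \<noteq> {}"
  obtains m where "m \<in> T" "\<And>t. t \<in> T \<Longrightarrow> m \<preceq> t"
  using assms unfolding wos_def well_ordered_in_def by meson

lemma wos_subset: "wos S \<Longrightarrow> T \<subseteq> S \<Longrightarrow> wos T"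
  by (auto simp: wos_def well_ordered_in_def)

lemma wos_Un:
  assumes "wos A" "wos B"
  shows "wos (A \<union> B)"
  unfolding wos_def well_ordered_in_def
proof (intro conjI allI impI)
  show "A \<union> B \<subseteq> carrier G" using assms by (auto simp: wos_def)
  fix T assume T: "T \<subseteq> A \<union> B" "T \<noteq> {}"
  show "\<exists>m\<in>T. \<forall>t\<in>T. m \<preceq> t"
  proof (cases "T \<inter> A = {} \<or> T \<inter> B = {}")
    case True
    then have "T \<subseteq> A \<or> T \<subseteq> B" using T by blast
    then show ?thesis using assms T(2) by (metis wos_least)
  next
    case False
    obtain a where a: "a \<in> T \<inter> A" "\<And>t. t \<in> T \<inter> A \<Longrightarrow> a \<preceq> t"
      using wos_least[OF assms(1), of "T \<inter> A"] False by blast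
    obtain b where b: "b \<in> T \<inter> B" "\<And>t. t \<in> T \<inter> B \<Longrightarrow> b \<preceq> t"
      using wos_least[OF assms(2), of "T \<inter> B"] False by blast
    have "a \<preceq> b \<or> b \<preceq> a"
      using le_or_lt a(1) b(1) assms by (meson IntD2 lt_imp_le wosD)
    then show ?thesis
    proof
      assume "a \<preceq> b"
      then have "\<forall>t\<in>T. a \<preceq> t" using T(1) a b le_trans by blast
      then show ?thesis using a(1) by blast
    next
      assume "b \<preceq> a"
      then have "\<forall>t\<in>T. b \<preceq> t" using T(1) a b le_trans by blast
      then show ?thesis using b(1) by blast
    qed
  qed
qed

lemma wos_singleton: "g \<in> carrier G \<Longrightarrow> wos {g}"
  by (auto simp: wos_def well_ordered_in_def subset_singleton_iff)

lemma wos_empty: "wos {}"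
  by (auto simp: wos_def well_ordered_in_def)

lemma wos_wf:
  assumes "wos A"
  shows "wf {(a, b). a \<in> A \<and> b \<in> A \<and> a \<prec> b}"
proof (rule wfI_min)
  fix x and Q :: "'a set"
  assume x: "x \<in> Q"
  show "\<exists>z\<in>Q. \<forall>y. (y, z) \<in> {(a, b). a \<in> A \<and> b \<in> A \<and> a \<prec> b} \<longrightarrow> y \<notin> Q"
  proof (cases "Q \<inter> A = {}")
    case True then show ?thesis using x by blast
  next
    case False
    then obtain m where m: "m \<in> Q \<inter> A" "\<And>t. t \<in> Q \<inter> A \<Longrightarrow> m \<preceq> t"
      using wos_least[OF assms, of "Q \<inter> A"] by blast
    have "\<not> y \<prec> m" if "y \<in> Q" "y \<in> A" for y
      using m(2)[of y] that le_lt_trans[of m y m] by auto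
    then show ?thesis using m(1) by blast
  qed
qed

text \<open>Take the least right factor \<open>h\<close> that occurs in a representation of an element of
  \<open>T\<close>, with left factor \<open>a0\<close>. Elements of \<open>T\<close> below \<open>a0 \<otimes>
  h\<close> have only representations with a left factor below \<open>a0\<close>, so well-founded induction on
  the left factor ends the search for a least element.\<close>

lemma wos_mult:
  assumes A: "wos A" and B: "wos B"
  shows "wos {a \<otimes> b | a b. a \<in> A \<and> b \<in> B}"
proof -
  have step: "\<exists>m\<in>T. \<forall>t\<in>T. m \<preceq> t"
    if bound: "\<And>a b. \<lbrakk>a \<in> A; b \<in> B; a \<otimes> b \<in> T\<rbrakk> \<Longrightarrow> Q a"
      and IH: "\<And>a' T'. \<lbrakk>a' \<in> A; Q a'; T' \<noteq> {}; T' \<subseteq> {a \<otimes> b | a b. a \<in> A \<and> b \<in> B};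
                \<And>a b. \<lbrakk>a \<in> A; b \<in> B; a \<otimes> b \<in> T'\<rbrakk> \<Longrightarrow> a \<prec> a'\<rbrakk> \<Longrightarrow> \<exists>m\<in>T'. \<forall>t\<in>T'. m \<preceq> t"
      and T: "T \<noteq> {}" "T \<subseteq> {a \<otimes> b | a b. a \<in> A \<and> b \<in> B}" for T Q
  proof -
    let ?H = "{b \<in> B. \<exists>a\<in>A. a \<otimes> b \<in> T}"
    have "?H \<noteq> {}" using T by blast
    then obtain h where h: "h \<in> ?H" "\<And>b. b \<in> ?H \<Longrightarrow> h \<preceq> b"
      using wos_least[OF B, of ?H] by blast
    then obtain a0 where a0: "a0 \<in> A" "a0 \<otimes> h \<in> T" by blast
    have h_in: "h \<in> B" using h(1) by simp
    have T_car: "t \<in> carrier G" if "t \<in> T" for t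
    proof -
      obtain a b where "t = a \<otimes> b" "a \<in> A" "b \<in> B" using T(2) \<open>t \<in> T\<close> by blast
      then show ?thesis using wosD[OF A] wosD[OF B] by simp
    qed
    let ?T' = "{t \<in> T. t \<prec> a0 \<otimes> h}"
    show ?thesis
    proof (cases "?T' = {}")
      case True
      then have "\<forall>t\<in>T. a0 \<otimes> h \<preceq> t"
        using le_or_lt[OF T_car[OF a0(2)]] T_car by blast
      then show ?thesis using a0(2) by blast
    next
      case False
      \<comment> \<open>A smaller product has its right factor at least \<open>h\<close>, so its left factor is below \<open>a0\<close>.\<close>
      have "a \<prec> a0" if "a \<in> A" "b \<in> B" "a \<otimes> b \<in> ?T'" for a b
      proof (rule ccontr)
        assume "\<not> a \<prec> a0"
        then have "a0 \<preceq> a" using le_or_lt a0(1) that(1) A by (metis wosD)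
        moreover have "h \<preceq> b" using h(2) that by blast
        ultimately have "a0 \<otimes> h \<preceq> a \<otimes> b" by (rule mult_mono_le)
        then show False using that(3) le_lt_trans[of "a0 \<otimes> h" "a \<otimes> b" "a0 \<otimes> h"] by simp
      qed
      then obtain m where m: "m \<in> ?T'" "\<And>t. t \<in> ?T' \<Longrightarrow> m \<preceq> t"
        using IH[of a0 ?T'] bound[OF a0(1) h_in a0(2)] a0(1) False T(2) by blast
      have "m \<preceq> t" if "t \<in> T" for t
      proof (cases "t \<prec> a0 \<otimes> h")
        case True then show ?thesis using m(2) that by blast
      next
        case False
        then have "a0 \<otimes> h \<preceq> t" using le_or_lt[OF T_car[OF a0(2)] T_car[OF that]] by blast
        then show ?thesis using m(1) lt_imp_le le_trans by blast
      qed
      then show ?thesis using m(1) by blast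
    qed
  qed
  have below: "\<exists>m\<in>T. \<forall>t\<in>T. m \<preceq> t"
    if "g \<in> A" "T \<noteq> {}" "T \<subseteq> {a \<otimes> b | a b. a \<in> A \<and> b \<in> B}"
      "\<And>a b. \<lbrakk>a \<in> A; b \<in> B; a \<otimes> b \<in> T\<rbrakk> \<Longrightarrow> a \<prec> g" for g T
    using wos_wf[OF A] that
  proof (induction g arbitrary: T rule: wf_induct_rule)
    case (less g)
    show ?case
    proof (rule step[where Q = "\<lambda>a. a \<prec> g"])
      show "\<exists>m\<in>T'. \<forall>t\<in>T'. m \<preceq> t"
        if "a' \<in> A" "a' \<prec> g" "T' \<noteq> {}" "T' \<subseteq> {a \<otimes> b | a b. a \<in> A \<and> b \<in> B}"
          "\<And>a b. \<lbrakk>a \<in> A; b \<in> B; a \<otimes> b \<in> T'\<rbrakk> \<Longrightarrow> a \<prec> a'" for a' T'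
        using less.IH[of a' T'] that less.prems(1) by auto
    qed (use less.prems in auto)
  qed
  have "\<exists>m\<in>T. \<forall>t\<in>T. m \<preceq> t" if "T \<noteq> {}" "T \<subseteq> {a \<otimes> b | a b. a \<in> A \<and> b \<in> B}" for T
    by (rule step[where Q = "\<lambda>_. True"]) (simp, rule below, assumption+, (use that in blast)+)
  moreover have "{a \<otimes> b | a b. a \<in> A \<and> b \<in> B} \<subseteq> carrier G"
    using wosD[OF A] wosD[OF B] by auto
  ultimately show ?thesis
    unfolding wos_def well_ordered_in_def by blast
qed

text \<open>The least element with an infinite initial segment would have a predecessor with an infinite initial segment.\<close>

lemma finite_if_min_max:
  assumes car: "P \<subseteq> carrier G"
    and min: "\<And>T. T \<subseteq> P \<Longrightarrow> T \<noteq> {} \<Longrightarrow> \<exists>m\<in>T. \<forall>t\<in>T. m \<preceq> t"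
    and max: "\<And>T. T \<subseteq> P \<Longrightarrow> T \<noteq> {} \<Longrightarrow> \<exists>m\<in>T. \<forall>t\<in>T. t \<preceq> m"
  shows "finite P"
proof -
  have fin: "finite {p \<in> P. p \<preceq> g}" if "g \<in> P" for g
  proof (rule ccontr)
    assume "infinite {p \<in> P. p \<preceq> g}"
    then have "{q \<in> P. infinite {p \<in> P. p \<preceq> q}} \<noteq> {}" using that by blast
    then obtain q where q: "q \<in> P" "infinite {p \<in> P. p \<preceq> q}"
      "\<And>t. t \<in> P \<Longrightarrow> infinite {p \<in> P. p \<preceq> t} \<Longrightarrow> q \<preceq> t"
      using min[of "{q \<in> P. infinite {p \<in> P. p \<preceq> q}}"] by auto
    have eq: "{p \<in> P. p \<preceq> q} = insert q {p \<in> P. p \<prec> q}"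
      using q(1) car by (auto simp: lt_def)
    have "{p \<in> P. p \<prec> q} \<noteq> {}"
    proof
      assume "{p \<in> P. p \<prec> q} = {}"
      then show False using q(2) unfolding eq by (metis finite.emptyI finite_insert)
    qed
    then obtain q' where q': "q' \<in> P" "q' \<prec> q" "\<And>t. t \<in> P \<Longrightarrow> t \<prec> q \<Longrightarrow> t \<preceq> q'"
      using max[of "{p \<in> P. p \<prec> q}"] by auto
    then have "{p \<in> P. p \<prec> q} \<subseteq> {p \<in> P. p \<preceq> q'}" by blast
    then have "infinite {p \<in> P. p \<preceq> q'}"
      using q(2) unfolding eq by (meson finite_insert finite_subset)
    then show False using q(3)[OF q'(1)] q'(2) by (metis le_lt_trans lt_irrefl)
  qed
  show ?thesis
  proof (cases "P = {}")
    case False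
    then obtain m where "m \<in> P" "\<And>t. t \<in> P \<Longrightarrow> t \<preceq> m" using max[of P] by auto
    then have "P \<subseteq> {p \<in> P. p \<preceq> m}" by blast
    then show ?thesis using fin[OF \<open>m \<in> P\<close>] by (rule finite_subset)
  qed simp
qed

text \<open>The left factors inherit least elements from \<open>A\<close>. Since a larger left factor goes with a smaller
  right factor, they also inherit greatest elements from least elements of \<open>B\<close>.\<close>

lemma finite_factorizations:
  assumes A: "wos A" and B: "wos B"
  shows "finite {(g, h). g \<in> A \<and> h \<in> B \<and> g \<otimes> h = t}"
proof -
  let ?F = "{(g, h). g \<in> A \<and> h \<in> B \<and> g \<otimes> h = t}"
  have inA: "g \<in> carrier G" if "g \<in> A" for g using that A by (rule wosD[rotated])
  have inB: "g \<in> carrier G" if "g \<in> B" for g using that B by (rule wosD[rotated])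
  have "finite (fst ` ?F)"
  proof (rule finite_if_min_max)
    show "fst ` ?F \<subseteq> carrier G" using inA by auto
  next
    fix T assume "T \<subseteq> fst ` ?F" "T \<noteq> {}"
    moreover from this have "T \<subseteq> A" by auto
    ultimately show "\<exists>m\<in>T. \<forall>t\<in>T. m \<preceq> t" using wos_least[OF A, of T] by metis
  next
    fix T assume T: "T \<subseteq> fst ` ?F" "T \<noteq> {}"
    let ?H = "{h \<in> B. \<exists>g\<in>T. g \<otimes> h = t}"
    have "?H \<subseteq> B" "?H \<noteq> {}" using T by (auto, fastforce)
    then obtain h where h: "h \<in> ?H" "\<And>k. k \<in> ?H \<Longrightarrow> h \<preceq> k"
      by (rule wos_least[OF B]) blast
    then obtain g where g: "g \<in> T" "g \<otimes> h = t" by blast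
    have "g' \<preceq> g" if g': "g' \<in> T" for g'
    proof (rule ccontr)
      assume "\<not> g' \<preceq> g"
      moreover have "g \<in> A" "g' \<in> A" using g(1) g' T(1) by auto
      ultimately have "g \<prec> g'" using not_le_iff[of g' g] inA by simp
      moreover obtain k where k: "k \<in> B" "g' \<otimes> k = t" using T(1) g' by auto
      ultimately have "g \<otimes> h \<prec> g' \<otimes> k" using h(2) g' by (intro mult_lt_le) auto
      then show False using g(2) k(2) by simp
    qed
    then show "\<exists>m\<in>T. \<forall>t\<in>T. t \<preceq> m" using g(1) by blast
  qed
  moreover have "inj_on fst ?F"
    using inA inB by (auto simp: inj_on_def)
  ultimately show ?thesis by (rule finite_imageD)
qed

end

section \<open>The ring of Mal'cev--Neumann series\<close>

locale malcev_neumann_ring = ordered_group G ord for G (structure) and ord :: "'a rel" +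
  fixes D :: "('a \<Rightarrow> 'k::field) ring"
  assumes D_eq: "D = malcev_neumann G ord"
begin

abbreviation series :: "('a \<Rightarrow> 'k) set" where "series \<equiv> carrier D"
abbreviation mul (infixl "\<star>" 70) where "\<alpha> \<star> \<beta> \<equiv> \<alpha> \<otimes>\<^bsub>D\<^esub> \<beta>"

lemma series_iff: "\<alpha> \<in> series \<longleftrightarrow> wos (supp \<alpha>)"
  by (auto simp: D_eq malcev_neumann_def wos_def)

lemma mult_def: "(\<alpha> \<star> \<beta>) t =
    (\<Sum>(g, h)\<in>{(g, h). g \<in> supp \<alpha> \<and> h \<in> supp \<beta> \<and> g \<otimes> h = t}. \<alpha> g * \<beta> h)"
  by (simp add: D_eq malcev_neumann_def)

lemma D_add: "\<alpha> \<oplus>\<^bsub>D\<^esub> \<beta> = \<alpha> + \<beta>"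
  by (simp add: D_eq malcev_neumann_def plus_fun_def)

lemma D_zero: "\<zero>\<^bsub>D\<^esub> = 0"
  by (simp add: D_eq malcev_neumann_def zero_fun_def)

lemma D_one: "\<one>\<^bsub>D\<^esub> = (\<lambda>g. if g = \<one> then 1 else 0)"
  by (simp add: D_eq malcev_neumann_def)

lemma series_nonzero_carrier: "\<alpha> \<in> series \<Longrightarrow> \<alpha> g \<noteq> 0 \<Longrightarrow> g \<in> carrier G"
  by (auto simp: series_iff supp_def dest: wosD)

lemma series_subset: "wos A \<Longrightarrow> supp \<alpha> \<subseteq> A \<Longrightarrow> \<alpha> \<in> series"
  by (auto simp: series_iff intro: wos_subset)

lemma zero_series [simp, intro]: "0 \<in> series"
  using wos_empty by (simp add: series_iff supp_def)

lemma add_series [simp, intro]: "\<alpha> \<in> series \<Longrightarrow> \<beta> \<in> series \<Longrightarrow> \<alpha> + \<beta> \<in> series"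
  by (rule series_subset[of "supp \<alpha> \<union> supp \<beta>"]) (auto simp: series_iff wos_Un supp_def)

lemma uminus_series [simp, intro]: "\<alpha> \<in> series \<Longrightarrow> - \<alpha> \<in> series"
  by (rule series_subset[of "supp \<alpha>"]) (auto simp: series_iff supp_def)

lemma diff_series [simp, intro]: "\<alpha> \<in> series \<Longrightarrow> \<beta> \<in> series \<Longrightarrow> \<alpha> - \<beta> \<in> series"
  by (metis add_series uminus_series add_uminus_conv_diff)

text \<open>The defining sum of a product ranges over the supports of the factors. Larger well-ordered sets may be used
  instead, which makes products with different supports comparable.\<close>

lemma mult_eq:
  assumes "wos A" "wos B" "supp \<alpha> \<subseteq> A" "supp \<beta> \<subseteq> B"
  shows "(\<alpha> \<star> \<beta>) t = (\<Sum>(g, h)\<in>{(g, h). g \<in> A \<and> h \<in> B \<and> g \<otimes> h = t}. \<alpha> g * \<beta> h)"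
  unfolding mult_def
  by (rule sum.mono_neutral_left[OF finite_factorizations[OF assms(1,2)]])
     (use assms in \<open>auto simp: supp_def\<close>)

lemma mult_nonzeroE:
  assumes "(\<alpha> \<star> \<beta>) t \<noteq> 0"
  obtains g h where "\<alpha> g \<noteq> 0" "\<beta> h \<noteq> 0" "g \<otimes> h = t"
proof -
  have "{(g, h). g \<in> supp \<alpha> \<and> h \<in> supp \<beta> \<and> g \<otimes> h = t} \<noteq> {}"
    using assms unfolding mult_def by (metis (no_types, lifting) sum.empty)
  then show ?thesis using that by (auto simp: supp_def)
qed

lemma supp_mult: "supp (\<alpha> \<star> \<beta>) \<subseteq> {a \<otimes> b | a b. a \<in> supp \<alpha> \<and> b \<in> supp \<beta>}"
  by (auto simp: supp_def elim!: mult_nonzeroE)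

lemma mult_series [simp, intro]: "\<alpha> \<in> series \<Longrightarrow> \<beta> \<in> series \<Longrightarrow> \<alpha> \<star> \<beta> \<in> series"
  by (rule series_subset[OF _ supp_mult]) (auto simp: series_iff intro: wos_mult)

lemma mult_add_left:
  assumes "\<alpha> \<in> series" "\<beta> \<in> series" "\<gamma> \<in> series"
  shows "(\<alpha> + \<beta>) \<star> \<gamma> = \<alpha> \<star> \<gamma> + \<beta> \<star> \<gamma>"
proof
  fix t
  note eq = mult_eq[of "supp \<alpha> \<union> supp \<beta>" "supp \<gamma>" _ \<gamma> t]
  have "wos (supp \<alpha> \<union> supp \<beta>)" "wos (supp \<gamma>)" using assms by (auto simp: series_iff intro: wos_Un)
  moreover have "supp (\<alpha> + \<beta>) \<subseteq> supp \<alpha> \<union> supp \<beta>" by (auto simp: supp_def)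
  ultimately show "((\<alpha> + \<beta>) \<star> \<gamma>) t = (\<alpha> \<star> \<gamma> + \<beta> \<star> \<gamma>) t"
    using eq[of "\<alpha> + \<beta>"] eq[of \<alpha>] eq[of \<beta>]
    by (simp add: distrib_right sum.distrib case_prod_unfold)
qed

lemma mult_add_right:
  assumes "\<alpha> \<in> series" "\<beta> \<in> series" "\<gamma> \<in> series"
  shows "\<gamma> \<star> (\<alpha> + \<beta>) = \<gamma> \<star> \<alpha> + \<gamma> \<star> \<beta>"
proof
  fix t
  note eq = mult_eq[of "supp \<gamma>" "supp \<alpha> \<union> supp \<beta>" \<gamma> _ t]
  have "wos (supp \<alpha> \<union> supp \<beta>)" "wos (supp \<gamma>)" using assms by (auto simp: series_iff intro: wos_Un)
  moreover have "supp (\<alpha> + \<beta>) \<subseteq> supp \<alpha> \<union> supp \<beta>" by (auto simp: supp_def)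
  ultimately show "(\<gamma> \<star> (\<alpha> + \<beta>)) t = (\<gamma> \<star> \<alpha> + \<gamma> \<star> \<beta>) t"
    using eq[of "\<alpha> + \<beta>"] eq[of \<alpha>] eq[of \<beta>]
    by (simp add: distrib_left sum.distrib case_prod_unfold)
qed

text \<open>Both sides are sums over the triples of support elements with product \<open>t\<close>.\<close>

lemma mult_assoc:
  assumes "\<alpha> \<in> series" "\<beta> \<in> series" "\<gamma> \<in> series"
  shows "\<alpha> \<star> \<beta> \<star> \<gamma> = \<alpha> \<star> (\<beta> \<star> \<gamma>)"
proof
  fix t
  let ?A = "supp \<alpha>" and ?B = "supp \<beta>" and ?C = "supp \<gamma>"
  let ?AB = "{a \<otimes> b | a b. a \<in> ?A \<and> b \<in> ?B}" and ?BC = "{a \<otimes> b | a b. a \<in> ?B \<and> b \<in> ?C}"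
  have w: "wos ?A" "wos ?B" "wos ?C" using assms by (auto simp: series_iff)
  have w2: "wos ?AB" "wos ?BC" using w by (auto intro: wos_mult)
  let ?F = "\<lambda>A B t. {(g, h). g \<in> A \<and> h \<in> B \<and> g \<otimes> h = t}"
  have car: "g \<in> carrier G" if "g \<in> ?A \<or> g \<in> ?B \<or> g \<in> ?C" for g
    using that w by (auto dest: wosD)
  have "(\<alpha> \<star> \<beta> \<star> \<gamma>) t = (\<Sum>(u, c)\<in>?F ?AB ?C t. (\<Sum>(a, b)\<in>?F ?A ?B u. \<alpha> a * \<beta> b) * \<gamma> c)"
    by (subst mult_eq[OF w2(1) w(3) supp_mult order_refl]) (simp add: mult_def)
  also have "\<dots> = (\<Sum>p\<in>?F ?AB ?C t. \<Sum>q\<in>?F ?A ?B (fst p). \<alpha> (fst q) * \<beta> (snd q) * \<gamma> (snd p))"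
    by (simp add: case_prod_unfold sum_distrib_right)
  also have "\<dots> = (\<Sum>(p, q)\<in>Sigma (?F ?AB ?C t) (\<lambda>p. ?F ?A ?B (fst p)).
                     \<alpha> (fst q) * \<beta> (snd q) * \<gamma> (snd p))"
    by (intro sum.Sigma ballI finite_factorizations w w2)
  also have "\<dots> = (\<Sum>(p, q)\<in>Sigma (?F ?A ?BC t) (\<lambda>p. ?F ?B ?C (snd p)).
                     \<alpha> (fst p) * (\<beta> (fst q) * \<gamma> (snd q)))"
    by (rule sum.reindex_bij_witness[where
          i = "\<lambda>(p, q). ((fst p \<otimes> fst q, snd q), (fst p, fst q))" and
          j = "\<lambda>(p, q). ((fst q, snd q \<otimes> snd p), (snd q, snd p))"])
       (use car in \<open>auto simp: m_assoc mult.assoc, blast, metis m_assoc, blast\<close>)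
  also have "\<dots> = (\<Sum>p\<in>?F ?A ?BC t. \<Sum>q\<in>?F ?B ?C (snd p). \<alpha> (fst p) * (\<beta> (fst q) * \<gamma> (snd q)))"
    by (intro sum.Sigma[symmetric] ballI finite_factorizations w w2)
  also have "\<dots> = (\<Sum>(a, u)\<in>?F ?A ?BC t. \<alpha> a * (\<Sum>(b, c)\<in>?F ?B ?C u. \<beta> b * \<gamma> c))"
    by (simp add: case_prod_unfold sum_distrib_left)
  also have "\<dots> = (\<alpha> \<star> (\<beta> \<star> \<gamma>)) t"
    by (subst mult_eq[OF w(1) w2(2) order_refl supp_mult]) (simp add: mult_def)
  finally show "(\<alpha> \<star> \<beta> \<star> \<gamma>) t = (\<alpha> \<star> (\<beta> \<star> \<gamma>)) t" .
qed

definition monomial :: "'k \<Rightarrow> 'a \<Rightarrow> 'a \<Rightarrow> 'k" where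
  "monomial a g = (\<lambda>h. if h = g then a else 0)"

lemma monomial_series [simp, intro]: "g \<in> carrier G \<Longrightarrow> monomial a g \<in> series"
  by (rule series_subset[OF wos_singleton[of g]]) (auto simp: monomial_def supp_def)

lemma monomial_mult:
  assumes g: "g \<in> carrier G" and t: "t \<in> carrier G" and \<alpha>: "\<alpha> \<in> series"
  shows "(monomial a g \<star> \<alpha>) t = a * \<alpha> (inv g \<otimes> t)"
proof -
  have "(monomial a g \<star> \<alpha>) t =
      (\<Sum>(u, h)\<in>{(u, h). u \<in> {g} \<and> h \<in> insert (inv g \<otimes> t) (supp \<alpha>) \<and> u \<otimes> h = t}. monomial a g u * \<alpha> h)"
  proof (rule mult_eq)
    show "wos (insert (inv g \<otimes> t) (supp \<alpha>))"
      using wos_Un[OF wos_singleton[of "inv g \<otimes> t"]] \<alpha> g t by (simp add: series_iff)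
  qed (use g in \<open>auto simp: monomial_def supp_def wos_singleton\<close>)
  also have "{(u, h). u \<in> {g} \<and> h \<in> insert (inv g \<otimes> t) (supp \<alpha>) \<and> u \<otimes> h = t} = {(g, inv g \<otimes> t)}"
    using g t \<alpha> by (auto simp: m_assoc[symmetric] supp_def dest: series_nonzero_carrier)
  finally show ?thesis by (simp add: monomial_def)
qed

lemma mult_monomial:
  assumes g: "g \<in> carrier G" and t: "t \<in> carrier G" and \<alpha>: "\<alpha> \<in> series"
  shows "(\<alpha> \<star> monomial a g) t = \<alpha> (t \<otimes> inv g) * a"
proof -
  have "(\<alpha> \<star> monomial a g) t =
      (\<Sum>(h, u)\<in>{(h, u). h \<in> insert (t \<otimes> inv g) (supp \<alpha>) \<and> u \<in> {g} \<and> h \<otimes> u = t}. \<alpha> h * monomial a g u)"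
  proof (rule mult_eq)
    show "wos (insert (t \<otimes> inv g) (supp \<alpha>))"
      using wos_Un[OF wos_singleton[of "t \<otimes> inv g"]] \<alpha> g t by (simp add: series_iff)
  qed (use g in \<open>auto simp: monomial_def supp_def wos_singleton\<close>)
  also have "{(h, u). h \<in> insert (t \<otimes> inv g) (supp \<alpha>) \<and> u \<in> {g} \<and> h \<otimes> u = t} = {(t \<otimes> inv g, g)}"
    using g t \<alpha> by (auto simp: m_assoc supp_def dest: series_nonzero_carrier)
  finally show ?thesis by (simp add: monomial_def)
qed

lemma D_one_monomial: "\<one>\<^bsub>D\<^esub> = monomial 1 \<one>"
  by (simp add: D_one monomial_def)

lemma series_eqI:
  assumes "\<alpha> \<in> series" "\<beta> \<in> series" "\<And>t. t \<in> carrier G \<Longrightarrow> \<alpha> t = \<beta> t"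
  shows "\<alpha> = \<beta>"
  using assms series_nonzero_carrier by (intro ext) metis

lemma scalar_commutes:
  assumes "\<alpha> \<in> series"
  shows "monomial c \<one> \<star> \<alpha> = \<alpha> \<star> monomial c \<one>"
  by (rule series_eqI) (use assms in \<open>auto simp: monomial_mult mult_monomial\<close>)

lemma one_mult: "\<alpha> \<in> series \<Longrightarrow> monomial 1 \<one> \<star> \<alpha> = \<alpha>"
  by (rule series_eqI) (auto simp: monomial_mult)

sublocale D: ring D
proof (rule ringI)
  show "abelian_group D"
  proof (rule abelian_groupI)
    fix x assume "x \<in> series"
    then show "\<exists>y\<in>series. y \<oplus>\<^bsub>D\<^esub> x = \<zero>\<^bsub>D\<^esub>"
      by (intro bexI[of _ "- x"]) (auto simp: D_add D_zero)
  qed (auto simp: D_add D_zero add_ac)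
  show "monoid D"
    by (rule monoidI) (auto simp: D_one_monomial mult_assoc one_mult scalar_commutes[symmetric])
qed (auto simp: D_add mult_add_left mult_add_right)

lemma D_uminus: "\<alpha> \<in> series \<Longrightarrow> \<ominus>\<^bsub>D\<^esub> \<alpha> = - \<alpha>"
  by (rule D.minus_equality) (auto simp: D_add D_zero)

lemma mult_diff_left:
  assumes "\<alpha> \<in> series" "\<beta> \<in> series" "\<gamma> \<in> series"
  shows "(\<alpha> - \<beta>) \<star> \<gamma> = \<alpha> \<star> \<gamma> - \<beta> \<star> \<gamma>"
  using mult_add_left[of "\<alpha> - \<beta>" \<beta> \<gamma>] assms by simp

lemma mult_diff_right:
  assumes "\<alpha> \<in> series" "\<beta> \<in> series" "\<gamma> \<in> series"
  shows "\<gamma> \<star> (\<alpha> - \<beta>) = \<gamma> \<star> \<alpha> - \<gamma> \<star> \<beta>"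
  using mult_add_right[of "\<alpha> - \<beta>" \<beta> \<gamma>] assms by simp

section \<open>Leading terms and successive approximation\<close>

text \<open>A value inequality that also makes sense for the zero series. In the usual notation \<open>starts_from g
  \<alpha>\<close> is \<open>v(\<alpha>) \<ge> g\<close>, \<open>starts_after g \<alpha>\<close> is
  \<open>v(\<alpha>) > g\<close> and \<open>leads g \<alpha>\<close> is \<open>v(\<alpha>) = g\<close>.\<close>

definition starts_from :: "'a \<Rightarrow> ('a \<Rightarrow> 'k) \<Rightarrow> bool" where
  "starts_from g \<alpha> \<longleftrightarrow> (\<forall>t. \<alpha> t \<noteq> 0 \<longrightarrow> g \<preceq> t)"

definition starts_after :: "'a \<Rightarrow> ('a \<Rightarrow> 'k) \<Rightarrow> bool" where
  "starts_after g \<alpha> \<longleftrightarrow> (\<forall>t. \<alpha> t \<noteq> 0 \<longrightarrow> g \<prec> t)"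

definition leads :: "'a \<Rightarrow> ('a \<Rightarrow> 'k) \<Rightarrow> bool" where
  "leads g \<alpha> \<longleftrightarrow> starts_from g \<alpha> \<and> \<alpha> g \<noteq> 0"

lemma starts_after_iff: "starts_after g \<alpha> \<longleftrightarrow> starts_from g \<alpha> \<and> \<alpha> g = 0"
  by (auto simp: starts_after_def starts_from_def lt_def)

lemma leads_carrier: "leads g \<alpha> \<Longrightarrow> g \<in> carrier G"
  by (auto simp: leads_def starts_from_def dest: le_carrier)

lemma leads_exists:
  assumes "\<alpha> \<in> series" "\<alpha> \<noteq> 0"
  obtains g where "leads g \<alpha>"
proof -
  have "supp \<alpha> \<noteq> {}" using assms(2) by (auto simp: supp_def)
  then obtain g where "g \<in> supp \<alpha>" "\<And>t. t \<in> supp \<alpha> \<Longrightarrow> g \<preceq> t"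
    using assms(1) wos_least[of "supp \<alpha>" "supp \<alpha>"] by (auto simp: series_iff)
  then show ?thesis using that by (auto simp: leads_def starts_from_def supp_def)
qed

lemma leads_unique: "leads g \<alpha> \<Longrightarrow> leads h \<alpha> \<Longrightarrow> g = h"
  by (auto simp: leads_def starts_from_def intro: le_antisym)

lemma leads_nonzero: "leads g \<alpha> \<Longrightarrow> \<alpha> \<noteq> 0"
  by (auto simp: leads_def)

lemma leads_le: "leads g \<alpha> \<Longrightarrow> starts_from h \<alpha> \<Longrightarrow> h \<preceq> g"
  by (auto simp: leads_def starts_from_def)

lemma leads_lt: "leads g \<alpha> \<Longrightarrow> starts_after h \<alpha> \<Longrightarrow> h \<prec> g"
  by (auto simp: leads_def starts_after_def)

lemma starts_from_mono: "starts_from g \<alpha> \<Longrightarrow> h \<preceq> g \<Longrightarrow> starts_from h \<alpha>"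
  by (meson starts_from_def le_trans)

lemma starts_from_imp_after: "starts_from g \<alpha> \<Longrightarrow> h \<prec> g \<Longrightarrow> starts_after h \<alpha>"
  by (meson starts_from_def starts_after_def lt_le_trans)

lemma starts_from_add: "starts_from g \<alpha> \<Longrightarrow> starts_from g \<beta> \<Longrightarrow> starts_from g (\<alpha> + \<beta>)"
  unfolding starts_from_def by (metis add.right_neutral plus_fun_apply)

lemma starts_from_diff: "starts_from g \<alpha> \<Longrightarrow> starts_from g \<beta> \<Longrightarrow> starts_from g (\<alpha> - \<beta>)"
  unfolding starts_from_def by (metis diff_0_right fun_diff_def)

lemma starts_from_monomial: "g \<in> carrier G \<Longrightarrow> starts_from g (monomial a g)"
  by (auto simp: starts_from_def monomial_def)

lemma starts_from_mult: "starts_from g \<alpha> \<Longrightarrow> starts_from h \<beta> \<Longrightarrow> starts_from (g \<otimes> h) (\<alpha> \<star> \<beta>)"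
  unfolding starts_from_def by (metis mult_nonzeroE mult_mono_le)

lemma starts_after_mult_left:
  "starts_after g \<alpha> \<Longrightarrow> starts_from h \<beta> \<Longrightarrow> starts_after (g \<otimes> h) (\<alpha> \<star> \<beta>)"
  unfolding starts_from_def starts_after_def by (metis mult_nonzeroE mult_lt_le)

text \<open>By monotonicity \<open>(g, h)\<close> is the only pair that contributes to the coefficient at \<open>g
  \<otimes> h\<close>.\<close>

lemma mult_at_start:
  assumes \<alpha>: "\<alpha> \<in> series" "starts_from g \<alpha>" and \<beta>: "\<beta> \<in> series" "starts_from h \<beta>"
    and car: "g \<in> carrier G" "h \<in> carrier G"
  shows "(\<alpha> \<star> \<beta>) (g \<otimes> h) = \<alpha> g * \<beta> h"
proof -
  have "(\<alpha> \<star> \<beta>) (g \<otimes> h) = (\<Sum>(u, v)\<in>{(u, v). u \<in> insert g (supp \<alpha>) \<and>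
      v \<in> insert h (supp \<beta>) \<and> u \<otimes> v = g \<otimes> h}. \<alpha> u * \<beta> v)"
  proof (rule mult_eq)
    show "wos (insert g (supp \<alpha>))" "wos (insert h (supp \<beta>))"
      using wos_Un[OF wos_singleton[OF car(1)], of "supp \<alpha>"]
            wos_Un[OF wos_singleton[OF car(2)], of "supp \<beta>"] \<alpha> \<beta> by (simp_all add: series_iff)
  qed auto
  also have "{(u, v). u \<in> insert g (supp \<alpha>) \<and> v \<in> insert h (supp \<beta>) \<and> u \<otimes> v = g \<otimes> h} = {(g, h)}"
  proof -
    have "u = g \<and> v = h" if "u \<in> insert g (supp \<alpha>)" "v \<in> insert h (supp \<beta>)" "u \<otimes> v = g \<otimes> h" for u v
    proof -
      have "g \<preceq> u" "h \<preceq> v" using that(1,2) \<alpha>(2) \<beta>(2) car by (auto simp: starts_from_def supp_def)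
      then have "\<not> g \<prec> u" "\<not> h \<prec> v"
        using that(3) mult_lt_le[of g u h v] mult_le_lt[of g u h v] by auto
      then show ?thesis using \<open>g \<preceq> u\<close> \<open>h \<preceq> v\<close> by (auto simp: lt_def)
    qed
    then show ?thesis by auto
  qed
  finally show ?thesis by simp
qed

lemma leads_mult:
  assumes "\<alpha> \<in> series" "leads g \<alpha>" "\<beta> \<in> series" "leads h \<beta>"
  shows "leads (g \<otimes> h) (\<alpha> \<star> \<beta>)"
  using assms leads_carrier[OF assms(2)] leads_carrier[OF assms(4)]
  by (simp add: leads_def starts_from_mult mult_at_start)

lemma mult_nonzero: "\<alpha> \<in> series \<Longrightarrow> \<beta> \<in> series \<Longrightarrow> \<alpha> \<noteq> 0 \<Longrightarrow> \<beta> \<noteq> 0 \<Longrightarrow> \<alpha> \<star> \<beta> \<noteq> 0"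
  by (metis leads_exists leads_mult leads_nonzero)

lemma leads_one: "leads \<one> (monomial 1 \<one>)"
  by (auto simp: leads_def starts_from_def monomial_def)

text \<open>A transfinite form of Hensel's lemma: if the leading term of a nonzero residual \<open>E x\<close> can always
  be removed by a change of \<open>x\<close> of order \<open>\<phi> g\<close>, where \<open>g\<close> is the
  value of the residual, then \<open>E\<close> has a zero. Otherwise order the approximations by improvement. A
  chain has an upper bound, because later members agree with earlier ones on longer and longer initial segments
  of the group, and gluing these segments gives a well-ordered support. A maximal approximation could be
  improved, which is absurd. The set \<open>P\<close> restricts the supports, a condition that is stable under
  gluing.\<close>

lemma successive_approximation:
  fixes E :: "('a \<Rightarrow> 'k) \<Rightarrow> 'a \<Rightarrow> 'k" and \<phi> :: "'a \<Rightarrow> 'a" and P :: "'a set"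
  defines "U \<equiv> {x \<in> series. supp x \<subseteq> P}"
  assumes E_series: "\<And>x. x \<in> U \<Longrightarrow> E x \<in> series"
    and \<phi>_mono: "\<And>g h. g \<prec> h \<Longrightarrow> \<phi> g \<prec> \<phi> h"
    and continuous: "\<And>x y g. \<lbrakk>x \<in> U; y \<in> U; g \<in> carrier G; starts_from (\<phi> g) (y - x)\<rbrakk>
        \<Longrightarrow> starts_from g (E y - E x)"
    and improve: "\<And>x g. \<lbrakk>x \<in> U; leads g (E x)\<rbrakk>
        \<Longrightarrow> \<exists>y\<in>U. starts_from (\<phi> g) (y - x) \<and> starts_after g (E y)"
  shows "\<exists>x\<in>U. E x = 0"
proof (rule ccontr)
  assume no_zero: "\<not> (\<exists>x\<in>U. E x = 0)"
  have "\<exists>g. leads g (E x)" if "x \<in> U" for x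
    using E_series[OF that] no_zero that leads_exists by metis
  then obtain e where e: "\<And>x. x \<in> U \<Longrightarrow> leads (e x) (E x)" by metis
  have e_car: "e x \<in> carrier G" if "x \<in> U" for x using e[OF that] by (rule leads_carrier)
  define better where "better x y \<longleftrightarrow> x = y \<or> (e x \<prec> e y \<and> starts_from (\<phi> (e x)) (y - x))" for x y
  have U_series: "x \<in> series" if "x \<in> U" for x using that by (simp add: U_def)
  have better_trans: "better x z" if "better x y" "better y z" for x y z
  proof (cases "x = y \<or> y = z")
    case False
    then have *: "e x \<prec> e y" "starts_from (\<phi> (e x)) (y - x)" "e y \<prec> e z" "starts_from (\<phi> (e y)) (z - y)"
      using that by (auto simp: better_def)
    have "starts_from (\<phi> (e x)) (z - y)"
      using starts_from_mono[OF *(4)] \<phi>_mono[OF *(1)] lt_imp_le by blast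
    from starts_from_add[OF *(2) this] have "starts_from (\<phi> (e x)) (z - x)" by simp
    then show ?thesis using lt_trans[OF *(1,3)] by (simp add: better_def)
  qed (use that in auto)
  have "\<exists>m\<in>U. \<forall>a\<in>U. better m a \<longrightarrow> a = m"
  proof (rule predicate_Zorn)
    have "better x y \<Longrightarrow> better y x \<Longrightarrow> x = y" for x y
      using lt_trans[of "e x" "e y" "e x"] lt_irrefl by (auto simp: better_def)
    then show "partial_order_on U (relation_of better U)"
      using better_trans
      by (auto simp: partial_order_on_def preorder_on_def refl_on_def trans_def antisym_def
          relation_of_def better_def[of x x for x])
  next
    fix C assume "C \<in> Chains (relation_of better U)"
    then have C: "x \<in> U" "better x y \<or> better y x" if "x \<in> C" "y \<in> C" for x y
      using that by (auto simp: Chains_def relation_of_def)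
    show "\<exists>u\<in>U. \<forall>a\<in>C. better a u"
    proof (cases "\<exists>m\<in>C. \<forall>a\<in>C. better a m")
      case True then show ?thesis using C by blast
    next
      case no_max: False
      \<comment> \<open>Below \<open>\<phi> (e x)\<close> all later members of the chain agree with \<open>x\<close>.\<close>
      define u where "u g = (if \<exists>x\<in>C. g \<prec> \<phi> (e x) then (SOME x. x \<in> C \<and> g \<prec> \<phi> (e x)) g else 0)" for g
      have agree: "x g = y g" if "x \<in> C" "y \<in> C" "g \<prec> \<phi> (e x)" "g \<prec> \<phi> (e y)" for x y g
      proof -
        have "x g = y g" if "better x y" "g \<prec> \<phi> (e x)" for x y
        proof (cases "x = y")
          case False
          then have "starts_from (\<phi> (e x)) (y - x)" using that by (simp add: better_def)
          then have "(y - x) g = 0"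
            using that(2) unfolding starts_from_def by (metis le_lt_trans lt_irrefl)
          then show ?thesis by simp
        qed simp
        then show ?thesis using C(2)[OF that(1,2)] that(3,4) by metis
      qed
      have u_eq: "u g = x g" if "x \<in> C" "g \<prec> \<phi> (e x)" for x g
      proof -
        let ?y = "SOME x. x \<in> C \<and> g \<prec> \<phi> (e x)"
        have "?y \<in> C \<and> g \<prec> \<phi> (e ?y)" by (rule someI[of _ x]) (use that in simp)
        then show ?thesis using agree that unfolding u_def by auto
      qed
      \<comment> \<open>Without a greatest member every member has a strictly better successor, so that gluing yields
        something strictly better than each of them.\<close>
      have later: "\<exists>y\<in>C. e x \<prec> e y" if x: "x \<in> C" for x
      proof -
        obtain y where *: "y \<in> C" "\<not> better y x" using no_max x by meson
        then have "better x y" "x \<noteq> y" using C(2)[OF x *(1)] by (auto simp: better_def)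
        then show ?thesis using *(1) by (auto simp: better_def)
      qed
      have u_nonzero: "\<exists>x\<in>C. g \<prec> \<phi> (e x) \<and> x g = u g" if "u g \<noteq> 0" for g
        using that u_eq unfolding u_def by (metis (no_types, lifting))
      have u_U: "u \<in> U"
        unfolding U_def series_iff wos_def well_ordered_in_def
      proof (intro CollectI conjI allI impI subsetI)
        fix g assume "g \<in> supp u"
        then obtain x where x: "x \<in> C" "x g = u g" "u g \<noteq> 0" using u_nonzero by (auto simp: supp_def)
        then have "x \<in> U" using C by blast
        then show "g \<in> carrier G" "g \<in> P"
          using x series_nonzero_carrier[of x g] by (auto simp: U_def supp_def)
      next
        fix T assume T: "T \<subseteq> supp u" "T \<noteq> {}"
        then obtain t where t: "t \<in> T" by blast
        then have "u t \<noteq> 0" using T by (auto simp: supp_def)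
        then obtain x where x: "x \<in> C" "t \<prec> \<phi> (e x)" using u_nonzero by blast
        \<comment> \<open>Up to \<open>t\<close> the glued series agrees with the single series \<open>x\<close>.\<close>
        let ?S = "{s \<in> T. s \<preceq> t}"
        have S: "?S \<subseteq> supp x"
        proof
          fix s assume "s \<in> ?S"
          then have "u s \<noteq> 0" "s \<prec> \<phi> (e x)" using T(1) x(2) le_lt_trans by (auto simp: supp_def)
          then show "s \<in> supp x" using u_eq[OF x(1)] by (simp add: supp_def)
        qed
        have xs: "wos (supp x)" using C(1)[OF x(1) x(1)] by (simp add: U_def series_iff)
        have "t \<in> carrier G" using x(2) by (rule lt_carrier)
        then have "t \<in> ?S" using t by simp
        then obtain m where m: "m \<in> ?S" "\<And>s. s \<in> ?S \<Longrightarrow> m \<preceq> s"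
          using wos_least[OF xs S] by blast
        have "m \<preceq> s" if "s \<in> T" for s
        proof (cases "s \<preceq> t")
          case True then show ?thesis using m(2) that by blast
        next
          case False
          have "u s \<noteq> 0" using that T(1) by (auto simp: supp_def)
          then have "s \<in> carrier G" using u_nonzero by (metis lt_carrier(1))
          then have "t \<prec> s" using False not_le_iff \<open>t \<in> carrier G\<close> by blast
          then show ?thesis using m(1) le_lt_trans lt_imp_le by blast
        qed
        then show "\<exists>m\<in>T. \<forall>t\<in>T. m \<preceq> t" using m(1) by blast
      qed
      have close: "starts_from (\<phi> (e x)) (u - x)" if "x \<in> C" for x
        unfolding starts_from_def
      proof (intro allI impI)
        fix g assume g: "(u - x) g \<noteq> 0"
        have "g \<in> carrier G"
          using g u_U C(1)[OF that that] series_nonzero_carrier[of "u - x" g] by (auto simp: U_series)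
        moreover have "\<phi> (e x) \<in> carrier G"
        proof -
          obtain y where "e x \<prec> e y" using later[OF \<open>x \<in> C\<close>] by blast
          then show ?thesis using \<phi>_mono lt_carrier(1) by blast
        qed
        moreover have "\<not> g \<prec> \<phi> (e x)" using g u_eq[OF that] by auto
        ultimately show "\<phi> (e x) \<preceq> g" using not_le_iff by blast
      qed
      have e_le: "e x \<preceq> e u" if "x \<in> C" for x
      proof -
        have x: "x \<in> U" using C that by blast
        have "starts_from (e x) (E u - E x)"
          by (rule continuous[OF x u_U e_car[OF x] close[OF that]])
        moreover have "starts_from (e x) (E x)" using e[OF x] by (simp add: leads_def)
        ultimately have "starts_from (e x) (E u - E x + E x)" by (rule starts_from_add)
        then show ?thesis using leads_le[OF e[OF u_U]] by simp
      qed
      have "better x u" if "x \<in> C" for x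
      proof -
        obtain y where y: "y \<in> C" "e x \<prec> e y" using later[OF \<open>x \<in> C\<close>] by blast
        from y(2) have "e x \<prec> e u" using e_le[OF y(1)] by (rule lt_le_trans)
        then show ?thesis using close[OF that] by (simp add: better_def)
      qed
      then show ?thesis using u_U by blast
    qed
  qed
  then obtain m where m: "m \<in> U" "\<And>a. a \<in> U \<Longrightarrow> better m a \<Longrightarrow> a = m" by blast
  obtain y where y: "y \<in> U" "starts_from (\<phi> (e m)) (y - m)" "starts_after (e m) (E y)"
    using improve[OF m(1) e[OF m(1)]] by blast
  have "e m \<prec> e y" using leads_lt[OF e[OF y(1)] y(3)] .
  then have "better m y" using y(2) by (simp add: better_def)
  then have "y = m" using m(2) y(1) by blast
  then show False using \<open>e m \<prec> e y\<close> by simp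
qed

text \<open>The residual \<open>b x - 1\<close> with leading term \<open>c g\<close> is improved by subtracting \<open>(c
  / b\<^sub>h) h\<^sup>-\<^sup>1 g\<close> from \<open>x\<close>, where \<open>b\<^sub>h\<close> is the leading
  coefficient of \<open>b\<close> at \<open>h\<close>.\<close>

lemma right_inverse_exists:
  assumes b: "b \<in> series" "b \<noteq> 0"
  shows "\<exists>x\<in>series. b \<star> x = monomial 1 \<one>"
proof -
  obtain h where h: "leads h b" using leads_exists[OF b] .
  have hc: "h \<in> carrier G" using h by (rule leads_carrier)
  define E where "E x = b \<star> x - monomial 1 \<one>" for x
  have "\<exists>x\<in>{x \<in> series. supp x \<subseteq> UNIV}. E x = 0"
  proof (rule successive_approximation[where \<phi> = "\<lambda>g. inv h \<otimes> g"])
    show "E x \<in> series" if "x \<in> {x \<in> series. supp x \<subseteq> UNIV}" for x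
      using that b by (auto simp: E_def)
    show "inv h \<otimes> g \<prec> inv h \<otimes> k" if "g \<prec> k" for g k
      using that hc by (simp add: lt_mult_left)
  next
    fix x y g
    assume xy: "x \<in> {x \<in> series. supp x \<subseteq> UNIV}" "y \<in> {x \<in> series. supp x \<subseteq> UNIV}"
      and g: "g \<in> carrier G" "starts_from (inv h \<otimes> g) (y - x)"
    have "E y - E x = b \<star> (y - x)" using xy b by (simp add: E_def mult_diff_right)
    moreover have "starts_from (h \<otimes> (inv h \<otimes> g)) (b \<star> (y - x))"
      using h g(2) by (auto simp: leads_def intro: starts_from_mult)
    ultimately show "starts_from g (E y - E x)" using hc g(1) by (simp add: m_assoc[symmetric])
  next
    fix x g
    assume x: "x \<in> {x \<in> series. supp x \<subseteq> UNIV}" and g: "leads g (E x)"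
    have gc: "g \<in> carrier G" using g by (rule leads_carrier)
    define \<eta> where "\<eta> = monomial (- E x g / b h) (inv h \<otimes> g)"
    have \<eta>: "\<eta> \<in> series" "starts_from (inv h \<otimes> g) \<eta>" "\<eta> (inv h \<otimes> g) = - E x g / b h"
      using hc gc unfolding \<eta>_def by (simp_all add: starts_from_monomial) (simp add: monomial_def)
    have hg: "h \<otimes> (inv h \<otimes> g) = g" using hc gc by (simp add: m_assoc[symmetric])
    have E: "E (x + \<eta>) = E x + b \<star> \<eta>" using x b \<eta> by (simp add: E_def mult_add_right)
    have "starts_from g (b \<star> \<eta>)" "(b \<star> \<eta>) g = - E x g"
      using starts_from_mult[of h b "inv h \<otimes> g" \<eta>] mult_at_start[of b h \<eta> "inv h \<otimes> g"] h b \<eta> hc gc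
      by (auto simp: leads_def hg)
    then have "starts_after g (E (x + \<eta>))"
      using g unfolding E by (auto simp: starts_after_iff leads_def intro: starts_from_add)
    then show "\<exists>y\<in>{x \<in> series. supp x \<subseteq> UNIV}. starts_from (inv h \<otimes> g) (y - x) \<and> starts_after g (E y)"
      using x \<eta> by (intro bexI[of _ "x + \<eta>"]) auto
  qed
  then show ?thesis by (auto simp: E_def)
qed

lemma series_Units:
  assumes b: "b \<in> series" "b \<noteq> 0"
  shows "b \<in> Units D"
proof -
  have nz: "monomial 1 \<one> \<noteq> 0" using leads_nonzero[OF leads_one] .
  obtain x where x: "x \<in> series" "b \<star> x = monomial 1 \<one>" using right_inverse_exists[OF b] by blast
  have "x \<noteq> 0"
  proof
    assume "x = 0"
    then have "b \<star> x = 0" using D.r_null[OF b(1)] by (simp add: D_zero)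
    then show False using x nz by simp
  qed
  then obtain y where y: "y \<in> series" "x \<star> y = monomial 1 \<one>" using right_inverse_exists x by blast
  have "b = y"
    using D.inv_unique[of b x y] b x y by (simp add: D_one_monomial)
  then show "b \<in> Units D" using b x y by (auto simp: Units_def D_one_monomial)
qed

end

section \<open>Conjugation into the centralizer of the leading group element\<close>

context group
begin

definition cent :: "'a \<Rightarrow> 'a set" where
  "cent z = {g \<in> carrier G. g \<otimes> z = z \<otimes> g}"

lemma subgroup_cent: "z \<in> carrier G \<Longrightarrow> subgroup (cent z) G"
proof (rule subgroupI)
  assume z: "z \<in> carrier G"
  show "cent z \<noteq> {}" using z by (auto simp: cent_def)
  fix a assume "a \<in> cent z"
  then have a: "a \<in> carrier G" "a \<otimes> z = z \<otimes> a" by (auto simp: cent_def)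
  have "inv a \<otimes> z = inv a \<otimes> (z \<otimes> a) \<otimes> inv a" using a(1) z by (simp add: m_assoc)
  also have "\<dots> = z \<otimes> inv a" unfolding a(2)[symmetric] using a(1) z by (simp add: m_assoc[symmetric])
  finally show "inv a \<in> cent z" using a(1) by (simp add: cent_def)
  fix b assume "b \<in> cent z"
  then have b: "b \<in> carrier G" "b \<otimes> z = z \<otimes> b" by (auto simp: cent_def)
  have "a \<otimes> b \<otimes> z = a \<otimes> z \<otimes> b" using a(1) b z by (simp add: m_assoc)
  then show "a \<otimes> b \<in> cent z" using a b z by (simp add: cent_def m_assoc)
qed (auto simp: cent_def)

end

context malcev_neumann_ring
begin

text \<open>For a subgroup \<open>C\<close> this is a homomorphism of bimodules over the ring of series supported in
  \<open>C\<close>, see \<open>proj_mult_left\<close> and \<open>proj_mult_right\<close>.\<close>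

definition proj :: "'a set \<Rightarrow> ('a \<Rightarrow> 'k) \<Rightarrow> 'a \<Rightarrow> 'k" where
  "proj C \<alpha> = (\<lambda>g. if g \<in> C then \<alpha> g else 0)"

lemma supp_proj: "supp (proj C \<alpha>) \<subseteq> C"
  by (auto simp: proj_def supp_def)

lemma proj_series [simp, intro]: "\<alpha> \<in> series \<Longrightarrow> proj C \<alpha> \<in> series"
  by (rule series_subset[of "supp \<alpha>"]) (auto simp: series_iff supp_def proj_def)

lemma proj_add: "proj C (\<alpha> + \<beta>) = proj C \<alpha> + proj C \<beta>"
  by (auto simp: proj_def)

lemma proj_diff: "proj C (\<alpha> - \<beta>) = proj C \<alpha> - proj C \<beta>"
  by (auto simp: proj_def)

lemma starts_from_proj: "starts_from g \<alpha> \<Longrightarrow> starts_from g (proj C \<alpha>)"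
  by (auto simp: proj_def starts_from_def)

text \<open>If \<open>g\<close> lies in the subgroup \<open>C\<close>, then \<open>g \<otimes> h\<close> lies in
  \<open>C\<close> exactly if \<open>h\<close> does.\<close>

lemma proj_mult_left:
  assumes C: "subgroup C G" and s: "s \<in> series" "supp s \<subseteq> C" and \<alpha>: "\<alpha> \<in> series"
  shows "proj C (s \<star> \<alpha>) = s \<star> proj C \<alpha>"
proof
  fix t
  show "proj C (s \<star> \<alpha>) t = (s \<star> proj C \<alpha>) t"
  proof (cases "t \<in> C")
    case True
    have "(s \<star> proj C \<alpha>) t =
        (\<Sum>(g, h)\<in>{(g, h). g \<in> supp s \<and> h \<in> supp \<alpha> \<and> g \<otimes> h = t}. s g * proj C \<alpha> h)"
      by (rule mult_eq) (use s \<alpha> in \<open>auto simp: series_iff supp_def proj_def\<close>)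
    also have "\<dots> = (s \<star> \<alpha>) t"
      unfolding mult_def
    proof (rule sum.cong)
      fix p assume "p \<in> {(g, h). g \<in> supp s \<and> h \<in> supp \<alpha> \<and> g \<otimes> h = t}"
      then obtain g h where p: "p = (g, h)" "g \<in> supp s" "h \<in> supp \<alpha>" "g \<otimes> h = t" by auto
      have gh: "g \<in> C" "h \<in> carrier G" using p s(2) \<alpha> by (auto simp: series_iff dest: wosD)
      then have "h = inv g \<otimes> t" using p(4) subgroup.mem_carrier[OF C] by (simp add: m_assoc[symmetric] flip: p(4))
      then have "h \<in> C" using True gh(1) C by (simp add: subgroup.m_closed subgroup.m_inv_closed)
      then show "(case p of (g, h) \<Rightarrow> s g * proj C \<alpha> h) = (case p of (g, h) \<Rightarrow> s g * \<alpha> h)"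
        by (simp add: p(1) proj_def)
    qed simp
    finally show ?thesis using True by (simp add: proj_def)
  next
    case False
    have "(s \<star> proj C \<alpha>) t = 0"
    proof (rule ccontr)
      assume "(s \<star> proj C \<alpha>) t \<noteq> 0"
      then obtain g h where "s g \<noteq> 0" "proj C \<alpha> h \<noteq> 0" "g \<otimes> h = t" by (rule mult_nonzeroE)
      then have "t \<in> C"
        using s(2) subgroup.m_closed[OF C, of g h] by (auto simp: supp_def proj_def split: if_splits)
      then show False using False by simp
    qed
    then show ?thesis using False by (simp add: proj_def)
  qed
qed

lemma proj_mult_right:
  assumes C: "subgroup C G" and s: "s \<in> series" "supp s \<subseteq> C" and \<alpha>: "\<alpha> \<in> series"
  shows "proj C (\<alpha> \<star> s) = proj C \<alpha> \<star> s"
proof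
  fix t
  show "proj C (\<alpha> \<star> s) t = (proj C \<alpha> \<star> s) t"
  proof (cases "t \<in> C")
    case True
    have "(proj C \<alpha> \<star> s) t =
        (\<Sum>(g, h)\<in>{(g, h). g \<in> supp \<alpha> \<and> h \<in> supp s \<and> g \<otimes> h = t}. proj C \<alpha> g * s h)"
      by (rule mult_eq) (use s \<alpha> in \<open>auto simp: series_iff supp_def proj_def\<close>)
    also have "\<dots> = (\<alpha> \<star> s) t"
      unfolding mult_def
    proof (rule sum.cong)
      fix p assume "p \<in> {(g, h). g \<in> supp \<alpha> \<and> h \<in> supp s \<and> g \<otimes> h = t}"
      then obtain g h where p: "p = (g, h)" "g \<in> supp \<alpha>" "h \<in> supp s" "g \<otimes> h = t" by auto
      have gh: "h \<in> C" "g \<in> carrier G" using p s(2) \<alpha> by (auto simp: series_iff dest: wosD)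
      then have "g = t \<otimes> inv h" using p(4) subgroup.mem_carrier[OF C] by (simp add: m_assoc flip: p(4))
      then have "g \<in> C" using True gh(1) C by (simp add: subgroup.m_closed subgroup.m_inv_closed)
      then show "(case p of (g, h) \<Rightarrow> proj C \<alpha> g * s h) = (case p of (g, h) \<Rightarrow> \<alpha> g * s h)"
        by (simp add: p(1) proj_def)
    qed simp
    finally show ?thesis using True by (simp add: proj_def)
  next
    case False
    have "(proj C \<alpha> \<star> s) t = 0"
    proof (rule ccontr)
      assume "(proj C \<alpha> \<star> s) t \<noteq> 0"
      then obtain g h where "proj C \<alpha> g \<noteq> 0" "s h \<noteq> 0" "g \<otimes> h = t" by (rule mult_nonzeroE)
      then have "t \<in> C"
        using s(2) subgroup.m_closed[OF C, of g h] by (auto simp: supp_def proj_def split: if_splits)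
      then show False using False by simp
    qed
    then show ?thesis using False by (simp add: proj_def)
  qed
qed

lemma commute_if_supports_commute:
  assumes "\<And>g h. g \<in> supp \<alpha> \<Longrightarrow> h \<in> supp \<beta> \<Longrightarrow> g \<otimes> h = h \<otimes> g"
  shows "\<alpha> \<star> \<beta> = \<beta> \<star> \<alpha>"
  unfolding mult_def fun_eq_iff
  by (intro allI sum.reindex_bij_witness[where i = prod.swap and j = prod.swap])
     (auto simp: mult.commute intro: assms assms[symmetric])

text \<open>The conjugating series is sought in the form \<open>X \<epsilon> = 1 + \<epsilon>\<close> with
  \<open>\<epsilon>\<close> supported outside \<open>C = cent z\<close> and above \<open>1\<close>. The series
  \<open>s\<close> is then forced: projecting \<open>X \<epsilon> t = s X \<epsilon>\<close> to \<open>C\<close>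
  gives \<open>s = proj C (X \<epsilon> t)\<close>, because \<open>X \<epsilon>\<close> projects to
  \<open>1\<close>. With this choice the residual \<open>E \<epsilon> = X \<epsilon> t - s X \<epsilon>\<close>
  has no terms in \<open>C\<close>. So its leading group element \<open>y\<close> does not commute with
  \<open>z\<close>, and \<open>y\<close> is the smaller one of the products \<open>p z\<close> and \<open>z
  p\<close>, either for \<open>p = y z\<^sup>-\<^sup>1\<close> or for \<open>p = z\<^sup>-\<^sup>1 y\<close>.
  Adding a multiple of \<open>p\<close> to \<open>\<epsilon>\<close> changes the residual by a multiple of
  \<open>p z - z p\<close> and by higher terms, so it can remove the leading term.\<close>

lemma conjugate_into_centralizer:
  assumes t: "t \<in> series" "leads z t"
  obtains x s where "x \<in> series" "leads \<one> x" "s \<in> series" "supp s \<subseteq> cent z" "x \<star> t = s \<star> x"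
proof -
  let ?C = "cent z"
  have z: "z \<in> carrier G" using t(2) by (rule leads_carrier)
  have C: "subgroup ?C G" using z by (rule subgroup_cent)
  have zC: "z \<in> ?C" using z by (simp add: cent_def)
  have oneC: "\<one> \<in> ?C" using z by (simp add: cent_def)
  define P where "P = {g. \<one> \<prec> g \<and> g \<notin> ?C}"
  define U where "U = {x \<in> series. supp x \<subseteq> P}"
  define X where "X \<epsilon> = monomial 1 \<one> + \<epsilon>" for \<epsilon>
  define S where "S \<epsilon> = proj ?C (X \<epsilon> \<star> t)" for \<epsilon>
  define E where "E \<epsilon> = X \<epsilon> \<star> t - S \<epsilon> \<star> X \<epsilon>" for \<epsilon>
  have X: "X \<epsilon> \<in> series" "leads \<one> (X \<epsilon>)" "X \<epsilon> \<one> = 1" "proj ?C (X \<epsilon>) = monomial 1 \<one>" if "\<epsilon> \<in> U" for \<epsilon>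
  proof -
    have \<epsilon>: "\<epsilon> \<in> series" "\<And>g. \<epsilon> g \<noteq> 0 \<Longrightarrow> \<one> \<prec> g \<and> g \<notin> ?C"
      using that by (auto simp: U_def P_def supp_def)
    show "X \<epsilon> \<in> series" using \<epsilon> by (simp add: X_def)
    have "\<epsilon> \<one> = 0" using \<epsilon>(2) by force
    then show 1: "X \<epsilon> \<one> = 1" by (simp add: X_def monomial_def)
    have "starts_from \<one> \<epsilon>" using \<epsilon>(2) by (auto simp: starts_from_def intro: lt_imp_le)
    then have "starts_from \<one> (X \<epsilon>)"
      unfolding X_def by (intro starts_from_add starts_from_monomial) auto
    then show "leads \<one> (X \<epsilon>)" using 1 by (simp add: leads_def)
    show "proj ?C (X \<epsilon>) = monomial 1 \<one>"
      using \<epsilon>(2) oneC by (auto simp: X_def proj_def monomial_def fun_eq_iff)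
  qed
  have Xt: "X \<epsilon> \<star> t \<in> series" "starts_from z (X \<epsilon> \<star> t)" "(X \<epsilon> \<star> t) z = t z" if "\<epsilon> \<in> U" for \<epsilon>
    using X[OF that] t z starts_from_mult[of \<one> "X \<epsilon>" z t] mult_at_start[of "X \<epsilon>" \<one> t z]
    by (auto simp: leads_def)
  have S: "S \<epsilon> \<in> series" "starts_from z (S \<epsilon>)" "S \<epsilon> z = t z" "supp (S \<epsilon>) \<subseteq> ?C" if "\<epsilon> \<in> U" for \<epsilon>
    using Xt[OF that] zC by (auto simp: S_def starts_from_proj supp_proj[THEN subsetD]) (simp add: proj_def)
  have E_series: "E \<epsilon> \<in> series" if "\<epsilon> \<in> U" for \<epsilon>
    using Xt[OF that] S[OF that] X[OF that] by (simp add: E_def)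
  have E_after: "starts_after z (E \<epsilon>)" if "\<epsilon> \<in> U" for \<epsilon>
  proof -
    have "starts_from z (S \<epsilon> \<star> X \<epsilon>)" "(S \<epsilon> \<star> X \<epsilon>) z = t z"
      using starts_from_mult[of z "S \<epsilon>" \<one> "X \<epsilon>"] mult_at_start[of "S \<epsilon>" z "X \<epsilon>" \<one>]
        S[OF that] X[OF that] z by (auto simp: leads_def)
    then show ?thesis using Xt[OF that] by (simp add: E_def starts_after_iff starts_from_diff)
  qed
  have E_off: "proj ?C (E \<epsilon>) = 0" if "\<epsilon> \<in> U" for \<epsilon>
  proof -
    have "proj ?C (S \<epsilon> \<star> X \<epsilon>) = S \<epsilon> \<star> monomial 1 \<one>"
      using proj_mult_left[OF C S(1,4)[OF that] X(1)[OF that]] X(4)[OF that] by simp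
    also have "\<dots> = S \<epsilon>" using D.r_one[OF S(1)[OF that]] by (simp add: D_one_monomial)
    finally show ?thesis by (simp add: E_def proj_diff S_def)
  qed
  have E_diff: "E (x + \<eta>) - E x = \<eta> \<star> t - proj ?C (\<eta> \<star> t) \<star> X (x + \<eta>) - S x \<star> \<eta>"
    if "x \<in> U" "x + \<eta> \<in> U" for x \<eta>
  proof -
    have \<eta>: "\<eta> \<in> series"
      using that diff_series[of "x + \<eta>" x] by (simp add: U_def)
    have 1: "X (x + \<eta>) = X x + \<eta>" by (simp add: X_def add.assoc)
    have 2: "X (x + \<eta>) \<star> t = X x \<star> t + \<eta> \<star> t"
      unfolding 1 using \<eta> X(1)[OF that(1)] t(1) by (simp add: mult_add_left)
    have 3: "S (x + \<eta>) = S x + proj ?C (\<eta> \<star> t)"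
      unfolding S_def 2 by (rule proj_add)
    have "S (x + \<eta>) \<star> X (x + \<eta>) = S x \<star> X (x + \<eta>) + proj ?C (\<eta> \<star> t) \<star> X (x + \<eta>)"
      unfolding 3 using \<eta> S(1) X(1) that t(1) by (intro mult_add_left) auto
    also have "S x \<star> X (x + \<eta>) = S x \<star> X x + S x \<star> \<eta>"
      unfolding 1 using \<eta> S(1) X(1) that by (intro mult_add_right) auto
    finally have 4: "S (x + \<eta>) \<star> X (x + \<eta>)
        = S x \<star> X x + S x \<star> \<eta> + proj ?C (\<eta> \<star> t) \<star> X (x + \<eta>)" .
    show ?thesis unfolding E_def 2 4 by simp
  qed
  \<comment> \<open>\<open>\<phi> g\<close> is the larger one of \<open>g z\<^sup>-\<^sup>1\<close> and \<open>z\<^sup>-\<^sup>1 g\<close>: then \<open>\<phi> g \<otimes> z\<close> and \<open>z \<otimes> \<phi> g\<close> are both at least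
    \<open>g\<close>, and one of them equals \<open>g\<close>.\<close>
  define \<phi> where "\<phi> g = (if g \<otimes> z \<prec> z \<otimes> g then g \<otimes> inv z else inv z \<otimes> g)" for g
  have \<phi>_ge: "g \<otimes> inv z \<preceq> \<phi> g" "inv z \<otimes> g \<preceq> \<phi> g" if g: "g \<in> carrier G" for g
  proof -
    have eq: "inv z \<otimes> (g \<otimes> z) \<otimes> inv z = inv z \<otimes> g" "inv z \<otimes> (z \<otimes> g) \<otimes> inv z = g \<otimes> inv z"
      using g z by (simp_all add: m_assoc) (simp add: m_assoc[symmetric])
    have "g \<otimes> inv z \<preceq> \<phi> g \<and> inv z \<otimes> g \<preceq> \<phi> g"
    proof (cases "g \<otimes> z \<prec> z \<otimes> g")
      case True
      then have "inv z \<otimes> (g \<otimes> z) \<otimes> inv z \<preceq> inv z \<otimes> (z \<otimes> g) \<otimes> inv z"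
        using z by (intro ord_mult_left ord_mult_right lt_imp_le) auto
      then show ?thesis unfolding eq using True g z by (simp add: \<phi>_def)
    next
      case False
      then have "z \<otimes> g \<preceq> g \<otimes> z" using g z not_le_iff by blast
      then have "inv z \<otimes> (z \<otimes> g) \<otimes> inv z \<preceq> inv z \<otimes> (g \<otimes> z) \<otimes> inv z"
        using z by (intro ord_mult_left ord_mult_right) auto
      then show ?thesis unfolding eq using False g z by (simp add: \<phi>_def)
    qed
    then show "g \<otimes> inv z \<preceq> \<phi> g" "inv z \<otimes> g \<preceq> \<phi> g" by auto
  qed
  have inv_z: "g \<otimes> inv z \<otimes> z = g" "z \<otimes> (inv z \<otimes> g) = g" if "g \<in> carrier G" for g
    using that z by (simp_all add: m_assoc) (simp add: m_assoc[symmetric])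
  have diff_from: "starts_from g (\<eta> \<star> t)" "starts_from g (S x \<star> \<eta>)"
    if "x \<in> U" "g \<in> carrier G" "starts_from (\<phi> g) \<eta>" for x \<eta> g
  proof -
    have "starts_from (g \<otimes> inv z) \<eta>" "starts_from (inv z \<otimes> g) \<eta>"
      using that starts_from_mono \<phi>_ge by blast+
    then have "starts_from (g \<otimes> inv z \<otimes> z) (\<eta> \<star> t)" "starts_from (z \<otimes> (inv z \<otimes> g)) (S x \<star> \<eta>)"
      using t(2) S(2)[OF that(1)] by (auto simp: leads_def intro!: starts_from_mult)
    then show "starts_from g (\<eta> \<star> t)" "starts_from g (S x \<star> \<eta>)"
      using inv_z that(2) by simp_all
  qed
  have "\<exists>x\<in>U. E x = 0"
  proof (rule successive_approximation[where \<phi> = \<phi> and P = P, folded U_def])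
    show "E x \<in> series" if "x \<in> U" for x using that by (rule E_series)
    show "\<phi> g \<prec> \<phi> h" if gh: "g \<prec> h" for g h
    proof (cases "g \<otimes> z \<prec> z \<otimes> g")
      case True
      have "g \<otimes> inv z \<prec> h \<otimes> inv z" using gh z by (simp add: lt_mult_right)
      also note \<phi>_ge(1)[OF lt_carrier(2)[OF gh]]
      finally (lt_le_trans) show ?thesis using True by (simp add: \<phi>_def[of g])
    next
      case False
      have "inv z \<otimes> g \<prec> inv z \<otimes> h" using gh z by (simp add: lt_mult_left)
      also note \<phi>_ge(2)[OF lt_carrier(2)[OF gh]]
      finally (lt_le_trans) show ?thesis using False by (simp add: \<phi>_def[of g])
    qed
  next
    fix x y g assume xy: "x \<in> U" "y \<in> U" and g: "g \<in> carrier G" "starts_from (\<phi> g) (y - x)"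
    have y: "x + (y - x) = y" by simp
    have "starts_from (g \<otimes> \<one>) (proj ?C ((y - x) \<star> t) \<star> X y)"
      using diff_from(1)[OF xy(1) g] X(2)[OF xy(2)]
      by (intro starts_from_mult starts_from_proj) (simp_all add: leads_def)
    then show "starts_from g (E y - E x)"
      using E_diff[of x "y - x"] xy diff_from[OF xy(1) g] g(1)
      unfolding y by (simp add: starts_from_diff)
  next
    fix x y assume x: "x \<in> U" and y: "leads y (E x)"
    have yc: "y \<in> carrier G" using y by (rule leads_carrier)
    have zy: "z \<prec> y" using leads_lt[OF y E_after[OF x]] .
    have yC: "y \<notin> ?C"
      using fun_cong[OF E_off[OF x], of y] y by (auto simp: proj_def leads_def)
    have noncomm: "y \<otimes> z \<noteq> z \<otimes> y" using yC yc by (simp add: cent_def)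
    let ?p = "\<phi> y"
    have p_cases: "?p = y \<otimes> inv z \<or> ?p = inv z \<otimes> y" by (simp add: \<phi>_def)
    have pc: "?p \<in> carrier G" using p_cases yc z by auto
    have pC: "?p \<notin> ?C"
    proof
      assume "?p \<in> ?C"
      then have "?p \<otimes> z \<in> ?C" "z \<otimes> ?p \<in> ?C" using C zC by (auto intro: subgroup.m_closed)
      then show False using p_cases inv_z[OF yc] yC by auto
    qed
    have p1: "\<one> \<prec> ?p"
    proof -
      have "z \<otimes> inv z \<prec> y \<otimes> inv z" using lt_mult_right[OF zy] z by blast
      then have "\<one> \<prec> y \<otimes> inv z" using z by simp
      then show ?thesis using \<phi>_ge(1)[OF yc] lt_le_trans by blast
    qed
    \<comment> \<open>The sign depends on whether \<open>y\<close> is \<open>p z\<close> or \<open>z p\<close>.\<close>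
    define a where "a = (if y \<otimes> z \<prec> z \<otimes> y then - E x y / t z else E x y / t z)"
    define \<eta> where "\<eta> = monomial a ?p"
    have \<eta>: "\<eta> \<in> series" "starts_from ?p \<eta>" "\<eta> ?p = a"
      using pc unfolding \<eta>_def by (simp_all add: starts_from_monomial) (simp add: monomial_def)
    have xU: "x + \<eta> \<in> U"
      using x \<eta>(1) p1 pC by (auto simp: U_def \<eta>_def P_def supp_def monomial_def split: if_splits)
    have \<eta>t: "starts_from y (\<eta> \<star> t)" and S\<eta>: "starts_from y (S x \<star> \<eta>)"
      using diff_from[OF x yc \<eta>(2)] .
    \<comment> \<open>As \<open>y\<close> is outside \<open>?C\<close>, the change of the projected factor starts only after \<open>y\<close>.\<close>
    have "starts_after y (proj ?C (\<eta> \<star> t))"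
      unfolding starts_after_iff using starts_from_proj[OF \<eta>t] yC by (simp add: proj_def)
    then have "starts_after (y \<otimes> \<one>) (proj ?C (\<eta> \<star> t) \<star> X (x + \<eta>))"
      using X(2)[OF xU] by (intro starts_after_mult_left) (simp_all add: leads_def)
    then have mid: "starts_after y (proj ?C (\<eta> \<star> t) \<star> X (x + \<eta>))" using yc by simp
    have tz: "t z \<noteq> 0" using t(2) by (simp add: leads_def)
    have "(\<eta> \<star> t) y - (S x \<star> \<eta>) y = - E x y"
    proof (cases "y \<otimes> z \<prec> z \<otimes> y")
      case True
      then have p: "?p = y \<otimes> inv z" by (simp add: \<phi>_def)
      have "(\<eta> \<star> t) (?p \<otimes> z) = a * t z"
        using mult_at_start[OF \<eta>(1,2) t(1) _ pc z] t(2) \<eta>(3) by (simp add: leads_def)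
      then have 1: "(\<eta> \<star> t) y = - E x y" using p inv_z[OF yc] True tz by (simp add: a_def)
      have "y \<otimes> z \<otimes> inv z \<prec> z \<otimes> y \<otimes> inv z" using True z by (simp add: lt_mult_right)
      then have "y \<prec> z \<otimes> ?p" using yc z p by (simp add: m_assoc)
      then have "starts_after y (S x \<star> \<eta>)"
        using starts_from_mult[OF S(2)[OF x] \<eta>(2)] starts_from_imp_after by blast
      then show ?thesis using 1 by (simp add: starts_after_iff)
    next
      case False
      then have p: "?p = inv z \<otimes> y" by (simp add: \<phi>_def)
      have "(S x \<star> \<eta>) (z \<otimes> ?p) = t z * a"
        using mult_at_start[OF S(1,2)[OF x] \<eta>(1,2) z pc] S(3)[OF x] \<eta>(3) by simp
      then have 1: "(S x \<star> \<eta>) y = E x y" using p inv_z[OF yc] False tz by (simp add: a_def)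
      have "z \<otimes> y \<prec> y \<otimes> z" using False noncomm not_le_iff yc z by (metis lt_def m_closed)
      then have "inv z \<otimes> (z \<otimes> y) \<prec> inv z \<otimes> (y \<otimes> z)" using z by (simp add: lt_mult_left)
      then have "y \<prec> ?p \<otimes> z" using yc z p by (simp add: m_assoc[symmetric])
      then have "starts_after y (\<eta> \<star> t)"
        using starts_from_mult[OF \<eta>(2), of z t] t(2) starts_from_imp_after by (auto simp: leads_def)
      then show ?thesis using 1 by (simp add: starts_after_iff)
    qed
    then have "(E (x + \<eta>) - E x) y = - E x y" "starts_from y (E (x + \<eta>) - E x)"
      unfolding E_diff[OF x xU] using \<eta>t S\<eta> mid
      by (auto simp: starts_after_iff intro!: starts_from_diff)
    then have "E (x + \<eta>) y = 0" "starts_from y (E (x + \<eta>))"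
      using y starts_from_add[of y "E (x + \<eta>) - E x" "E x"] by (simp_all add: leads_def)
    then have "starts_after y (E (x + \<eta>))" by (simp add: starts_after_iff)
    then show "\<exists>x'\<in>U. starts_from (\<phi> y) (x' - x) \<and> starts_after y (E x')"
      using xU \<eta>(2) by (intro bexI[of _ "x + \<eta>"]) auto
  qed
  then obtain \<epsilon> where \<epsilon>: "\<epsilon> \<in> U" "E \<epsilon> = 0" by blast
  show thesis
    using that[of "X \<epsilon>" "S \<epsilon>"] X[OF \<epsilon>(1)] S[OF \<epsilon>(1)] \<epsilon>(2) by (simp add: E_def)
qed

text \<open>After conjugation \<open>t\<close> is supported in \<open>cent z\<close>. The part of \<open>b\<close> in
  \<open>cent z\<close> then commutes with \<open>t\<close>, and the rest of \<open>b\<close> contributes only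
  terms outside \<open>cent z\<close>. Conjugation by a series of value \<open>1\<close> does not change the
  value of the commutator.\<close>

lemma leads_commutator_not_in_cent:
  assumes b: "b \<in> series" and t: "t \<in> series" "leads z t"
    and abelian: "\<And>g h. g \<in> cent z \<Longrightarrow> h \<in> cent z \<Longrightarrow> g \<otimes> h = h \<otimes> g"
    and y: "leads y (b \<star> t - t \<star> b)"
  shows "y \<notin> cent z"
proof -
  let ?C = "cent z"
  have C: "subgroup ?C G" using t(2) leads_carrier subgroup_cent by blast
  obtain x s where x: "x \<in> series" "leads \<one> x" and s: "s \<in> series" "supp s \<subseteq> ?C"
    and xt: "x \<star> t = s \<star> x" using conjugate_into_centralizer[OF t] .
  have "x \<in> Units D" using series_Units x leads_nonzero by blast
  then obtain x' where x': "x' \<in> series" "x \<star> x' = monomial 1 \<one>" "x' \<star> x = monomial 1 \<one>"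
    by (auto simp: Units_def D_one_monomial)
  have one_l: "monomial 1 \<one> \<star> \<alpha> = \<alpha>" and one_r: "\<alpha> \<star> monomial 1 \<one> = \<alpha>" if "\<alpha> \<in> series" for \<alpha>
    using D.l_one[OF that] D.r_one[OF that] by (simp_all add: D_one_monomial)
  define b' where "b' = x \<star> b \<star> x'"
  have b': "b' \<in> series" using x x' b by (simp add: b'_def)
  have "t \<star> x' = x' \<star> x \<star> (t \<star> x')" unfolding x'(3) using t(1) x'(1) by (simp add: one_l)
  also have "\<dots> = x' \<star> (x \<star> t) \<star> x'" using t(1) x(1) x'(1) by (simp add: mult_assoc)
  also have "\<dots> = x' \<star> s \<star> (x \<star> x')" unfolding xt using s(1) x(1) x'(1) by (simp add: mult_assoc)
  finally have tx': "t \<star> x' = x' \<star> s" using s x' by (simp add: one_r)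
  have "x \<star> (b \<star> t - t \<star> b) \<star> x' = x \<star> b \<star> (t \<star> x') - x \<star> t \<star> b \<star> x'"
    using x x' b t by (simp add: mult_diff_right mult_diff_left mult_assoc)
  also have "x \<star> b \<star> (t \<star> x') = b' \<star> s"
    unfolding tx' b'_def using x x' b s by (simp add: mult_assoc)
  also have "x \<star> t \<star> b \<star> x' = s \<star> b'"
    unfolding xt b'_def using x x' b s by (simp add: mult_assoc)
  finally have eq: "x \<star> (b \<star> t - t \<star> b) \<star> x' = b' \<star> s - s \<star> b'" .
  have "proj ?C b' \<star> s = s \<star> proj ?C b'"
    using abelian s(2) supp_proj[of ?C b'] by (intro commute_if_supports_commute) blast
  then have off: "proj ?C (b' \<star> s - s \<star> b') = 0"
    using proj_mult_left[OF C s b'] proj_mult_right[OF C s b'] by (simp add: proj_diff)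
  have "leads \<one> x'"
  proof -
    have "x' \<noteq> 0"
    proof
      assume "x' = 0"
      then have "x \<star> x' = 0" using D.r_null[OF x(1)] by (simp add: D_zero)
      then show False using x'(2) leads_nonzero[OF leads_one] by simp
    qed
    then obtain g where g: "leads g x'" using leads_exists x' by blast
    have "\<one> \<otimes> g = \<one>"
      using leads_mult[OF x x'(1) g] leads_one unfolding x'(2) by (rule leads_unique)
    then show ?thesis using g leads_carrier[OF g] by simp
  qed
  moreover have "y \<in> carrier G" using y by (rule leads_carrier)
  moreover have "leads (\<one> \<otimes> y \<otimes> \<one>) (x \<star> (b \<star> t - t \<star> b) \<star> x')"
    using x x'(1) b t(1) y \<open>leads \<one> x'\<close> by (intro leads_mult) auto
  ultimately have "(b' \<star> s - s \<star> b') y \<noteq> 0" unfolding eq by (simp add: leads_def)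
  then show ?thesis using fun_cong[OF off, of y] by (auto simp: proj_def)
qed

section \<open>Maximal subfields\<close>

text \<open>Only two properties of the ordered group matter: centralizers of nontrivial elements are abelian, and an
  element commutes with none of its conjugates other than itself.\<close>

theorem maximal_subfield_self_invariant:
  assumes abelian: "\<And>z g h. \<lbrakk>z \<in> carrier G; z \<noteq> \<one>; g \<in> cent z; h \<in> cent z\<rbrakk> \<Longrightarrow> g \<otimes> h = h \<otimes> g"
    and conj: "\<And>z h. \<lbrakk>z \<in> carrier G; h \<in> carrier G; h \<otimes> z \<otimes> inv h \<in> cent z\<rbrakk> \<Longrightarrow> h \<in> cent z"
    and K: "maximal_subfield D K"
  shows "self_invariant D K"
proof -
  have sub: "subfield K D" and cK: "center D \<subseteq> K" and CK: "centralizer D K = K"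
    using K by (auto simp: maximal_subfield_def)
  note K_ring = subringE[OF subfieldE(1)[OF sub]]
  have K_series: "a \<in> series" if "a \<in> K" for a using that K_ring(1) by blast
  have K_comm: "a \<star> b = b \<star> a" if "a \<in> K" "b \<in> K" for a b using subfieldE(4)[OF sub] that .
  have K_zero: "0 \<in> K" using K_ring(2) by (simp add: D_zero)
  have K_diff: "a - b \<in> K" if "a \<in> K" "b \<in> K" for a b
  proof -
    have "a \<oplus>\<^bsub>D\<^esub> (\<ominus>\<^bsub>D\<^esub> b) \<in> K" using that K_ring(5,7) by blast
    then show ?thesis using that K_series by (simp add: D_add D_uminus)
  qed
  have K_scalar: "monomial c \<one> \<in> K" for c
    using cK by (auto simp: center_def centralizer_def scalar_commutes)
  have inv_mult: "inv\<^bsub>D\<^esub> b \<in> series" "b \<star> inv\<^bsub>D\<^esub> b = monomial 1 \<one>" "inv\<^bsub>D\<^esub> b \<star> b = monomial 1 \<one>"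
    if "b \<in> series" "b \<noteq> 0" for b
    using D.Units_inv_closed D.Units_r_inv D.Units_l_inv series_Units[OF that]
    by (simp_all add: D_one_monomial)
  have one_l: "monomial 1 \<one> \<star> \<alpha> = \<alpha>" and one_r: "\<alpha> \<star> monomial 1 \<one> = \<alpha>" if "\<alpha> \<in> series" for \<alpha>
    using D.l_one[OF that] D.r_one[OF that] by (simp_all add: D_one_monomial)
  have fixed: "b \<star> t = t \<star> b"
    if b: "b \<in> series" "b \<noteq> 0"
      and norm: "\<And>a. a \<in> K \<Longrightarrow> a \<noteq> 0 \<Longrightarrow> b \<star> a \<star> inv\<^bsub>D\<^esub> b \<in> K"
      and t: "t \<in> K" "leads z t" "z \<noteq> \<one>" for b t z
  proof (rule ccontr)
    assume noncomm: "b \<star> t \<noteq> t \<star> b"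
    have z: "z \<in> carrier G" using t(2) by (rule leads_carrier)
    define s where "s = b \<star> t \<star> inv\<^bsub>D\<^esub> b"
    have sK: "s \<in> K" unfolding s_def using norm[OF t(1) leads_nonzero[OF t(2)]] .
    have sb: "s \<star> b = b \<star> t"
      unfolding s_def using b K_series[OF t(1)] inv_mult[OF b] by (simp add: mult_assoc one_r)
    obtain h where h: "leads h b" using leads_exists[OF b] .
    have hc: "h \<in> carrier G" using h by (rule leads_carrier)
    have "s \<noteq> 0"
      using sb mult_nonzero[OF b(1) K_series[OF t(1)] b(2) leads_nonzero[OF t(2)]] D.l_null[OF b(1)]
      by (auto simp: D_zero)
    then obtain y where y: "leads y s" using leads_exists K_series[OF sK] by blast
    have yc: "y \<in> carrier G" using y by (rule leads_carrier)
    have "y \<otimes> h = h \<otimes> z"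
      using leads_mult[OF K_series[OF sK] y b(1) h] leads_mult[OF b(1) h K_series[OF t(1)] t(2)]
      unfolding sb by (rule leads_unique)
    then have "y = h \<otimes> z \<otimes> inv h" using yc hc z by (simp add: inv_solve_right)
    moreover have K_cent: "g \<in> cent z" if "leads g a" "a \<in> K" for g a
      using leads_unique[OF leads_mult[OF K_series[OF that(2)] that(1) K_series[OF t(1)] t(2)], of "z \<otimes> g"]
        leads_mult[OF K_series[OF t(1)] t(2) K_series[OF that(2)] that(1)]
        K_comm[OF that(2) t(1)] leads_carrier[OF that(1)] by (simp add: cent_def)
    ultimately have h_cent: "h \<in> cent z" using conj[OF z hc] y sK by auto
    have comm: "b \<star> t - t \<star> b = (s - t) \<star> b"
      using sb K_series sK t(1) b(1) by (simp add: mult_diff_left)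
    have "s - t \<noteq> 0" using noncomm sb by auto
    then obtain d where d: "leads d (s - t)"
      using leads_exists[OF K_series[OF K_diff[OF sK t(1)]]] by blast
    have "leads (d \<otimes> h) (b \<star> t - t \<star> b)"
      unfolding comm using K_series[OF K_diff[OF sK t(1)]] d b(1) h by (rule leads_mult)
    then have "d \<otimes> h \<notin> cent z"
      using abelian[OF z t(3)] b(1) K_series[OF t(1)] t(2) by (intro leads_commutator_not_in_cent) auto
    moreover have "d \<otimes> h \<in> cent z"
      using subgroup.m_closed[OF subgroup_cent[OF z] K_cent[OF d K_diff[OF sK t(1)]] h_cent] .
    ultimately show False by blast
  qed
  have norm_K: "b \<in> K"
    if b: "b \<in> series" "b \<noteq> 0"
      and norm: "\<And>a. a \<in> K \<Longrightarrow> a \<noteq> 0 \<Longrightarrow> b \<star> a \<star> inv\<^bsub>D\<^esub> b \<in> K" for b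
  proof -
    have "b \<star> a = a \<star> b" if a: "a \<in> K" for a
    proof -
      \<comment> \<open>Without its constant term \<open>a\<close> is zero or has a nontrivial value.\<close>
      define c where "c = a \<one>"
      define a' where "a' = a - monomial c \<one>"
      have a': "a' \<in> K" unfolding a'_def using a K_scalar by (rule K_diff)
      have "b \<star> a' = a' \<star> b"
      proof (cases "a' = 0")
        case True then show ?thesis using D.l_null[OF b(1)] D.r_null[OF b(1)] by (simp add: D_zero)
      next
        case False
        then obtain z where z: "leads z a'" using leads_exists K_series[OF a'] by blast
        have "a' \<one> = 0" by (simp add: a'_def c_def monomial_def)
        then have "z \<noteq> \<one>" using z by (auto simp: leads_def)
        then show ?thesis using fixed[OF b norm a' z] by blast
      qed
      moreover have "a = a' + monomial c \<one>" by (simp add: a'_def)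
      ultimately show ?thesis
        using scalar_commutes[OF b(1), of c] K_series[OF a'] b(1)
        by (simp add: mult_add_left mult_add_right)
    qed
    then have "b \<in> centralizer D K" using b(1) by (simp add: centralizer_def)
    then show ?thesis using CK by simp
  qed
  have K_norm: "b \<star> a \<star> inv\<^bsub>D\<^esub> b = a" if "a \<in> K" "b \<in> K" "b \<noteq> 0" for a b
  proof -
    have bs: "b \<in> series" "a \<in> series" using that K_series by auto
    have "b \<star> a \<star> inv\<^bsub>D\<^esub> b = a \<star> b \<star> inv\<^bsub>D\<^esub> b" using K_comm that by simp
    also have "\<dots> = a" using inv_mult[OF bs(1) that(3)] bs by (simp add: mult_assoc one_r)
    finally show ?thesis .
  qed
  show ?thesis
    unfolding self_invariant_def unit_normalizer_def D_zero
  proof (intro equalityI subsetI)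
    fix b assume b: "b \<in> {b \<in> series - {0}. (\<lambda>a. b \<star> a \<star> inv\<^bsub>D\<^esub> b) ` (K - {0}) \<subseteq> K - {0}} \<union> {0}"
    show "b \<in> K"
    proof (cases "b = 0")
      case False
      then have "b \<in> series" and sub: "(\<lambda>a. b \<star> a \<star> inv\<^bsub>D\<^esub> b) ` (K - {0}) \<subseteq> K - {0}"
        using b by simp_all
      show ?thesis
      proof (rule norm_K[OF \<open>b \<in> series\<close> False])
        show "b \<star> a \<star> inv\<^bsub>D\<^esub> b \<in> K" if "a \<in> K" "a \<noteq> 0" for a
          using subsetD[OF sub imageI[of a]] that by simp
      qed
    qed (use K_zero in simp)
  next
    fix b assume "b \<in> K"
    then show "b \<in> {b \<in> series - {0}. (\<lambda>a. b \<star> a \<star> inv\<^bsub>D\<^esub> b) ` (K - {0}) \<subseteq> K - {0}} \<union> {0}"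
      using K_norm K_series by (cases "b = 0") (simp_all add: image_subset_iff)
  qed
qed

end

section \<open>Reduced words and the free group\<close>

lemma inv_letter_inv_letter [simp]: "inv_letter (inv_letter a) = a"
  by (simp add: inv_letter_def)

lemma inv_letter_neq [simp]: "inv_letter a \<noteq> a" "a \<noteq> inv_letter a"
  by (auto simp: inv_letter_def prod_eq_iff)

lemma inv_letter_eq_iff [simp]: "inv_letter a = inv_letter b \<longleftrightarrow> a = b"
  by (metis inv_letter_inv_letter)

lemma reduced_Nil [simp]: "reduced []"
  by (simp add: reduced_def)

lemma reduced_Cons: "reduced (a # w) \<longleftrightarrow> (w = [] \<or> hd w \<noteq> inv_letter a) \<and> reduced w"
  by (auto simp: reduced_def successively_Cons)

lemma reduced_append:
  "reduced (u @ v) \<longleftrightarrow> reduced u \<and> reduced v \<and> (u = [] \<or> v = [] \<or> hd v \<noteq> inv_letter (last u))"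
  by (auto simp: reduced_def successively_append_iff)

definition inv_word :: "'x letter list \<Rightarrow> 'x letter list" where
  "inv_word w = rev (map inv_letter w)"

lemma reduced_inv_word: "reduced w \<Longrightarrow> reduced (inv_word w)"
  unfolding reduced_def inv_word_def
  by (auto simp: successively_map elim: successively_mono)

lemma reduced_cons_reduce: "reduced w \<Longrightarrow> reduced (cons_reduce a w)"
  by (cases w) (auto simp: reduced_Cons)

lemma cons_reduce_cancel: "reduced w \<Longrightarrow> cons_reduce (inv_letter a) (cons_reduce a w) = w"
proof (cases w)
  case (Cons b v)
  assume "reduced w"
  then show ?thesis by (cases v) (auto simp: Cons reduced_Cons)
qed simp

lemma cons_reduce_eq_Cons: "reduced (a # w) \<Longrightarrow> cons_reduce a w = a # w"
  by (cases w) (auto simp: reduced_Cons)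

lemma length_cons_reduce: "length (cons_reduce a w) \<le> Suc (length w)"
  "length (cons_reduce a w) = Suc (length w) \<Longrightarrow> cons_reduce a w = a # w"
  by (cases w; auto)+

lemma set_cons_reduce: "set (cons_reduce a w) \<subseteq> insert a (set w)"
  by (cases w) auto

abbreviation mult_words :: "'x letter list \<Rightarrow> 'x letter list \<Rightarrow> 'x letter list" where
  "mult_words u v \<equiv> foldr cons_reduce u v"

lemma reduced_mult_words: "reduced v \<Longrightarrow> reduced (mult_words u v)"
  by (induction u) (auto intro: reduced_cons_reduce)

lemma set_mult_words: "set (mult_words u v) \<subseteq> set u \<union> set v"
  using set_cons_reduce by (induction u) (simp, fastforce)

text \<open>Each letter acts on the reduced words by an invertible map, so the action of a word depends only on its
  reduction.\<close>

lemma mult_words_assoc: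
  assumes "reduced w"
  shows "mult_words (mult_words u v) w = mult_words u (mult_words v w)"
proof (induction u)
  case (Cons a u)
  have "mult_words (cons_reduce a v) w = cons_reduce a (mult_words v w)" for v
  proof (cases v)
    case (Cons b v')
    have "cons_reduce a (cons_reduce (inv_letter a) (mult_words v' w)) = mult_words v' w"
      using cons_reduce_cancel[of "mult_words v' w" "inv_letter a"] reduced_mult_words[OF assms] by simp
    then show ?thesis by (simp add: Cons)
  qed simp
  then show ?case by (simp add: Cons)
qed simp

lemma mult_words_append: "reduced (u @ v) \<Longrightarrow> mult_words u v = u @ v"
  by (induction u) (auto simp: reduced_Cons cons_reduce_eq_Cons)

lemma length_mult_words: "length (mult_words u v) \<le> length u + length v"
  by (induction u) (auto intro: order_trans[OF length_cons_reduce(1)])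

lemma mult_words_eq_append_if_length:
  "length (mult_words u v) = length u + length v \<Longrightarrow> mult_words u v = u @ v"
proof (induction u)
  case (Cons a u)
  have "length (mult_words u v) = length u + length v"
    using Cons.prems length_cons_reduce(1)[of a "mult_words u v"] length_mult_words[of u v] by simp
  then show ?case using Cons length_cons_reduce(2)[of a "mult_words u v"] by simp
qed simp

lemma inv_word_mult_words: "mult_words (inv_word w) w = []"
  by (induction w) (simp_all add: inv_word_def)

context
  fixes X :: "'x set"
begin

lemma free_group_carrier: "w \<in> carrier (free_group X) \<longleftrightarrow> w \<in> lists (X \<times> UNIV) \<and> reduced w"
  by (simp add: free_group_def)

lemma free_group_mult: "u \<otimes>\<^bsub>free_group X\<^esub> v = mult_words u v"
  by (simp add: free_group_def)

lemma free_group_one: "\<one>\<^bsub>free_group X\<^esub> = []"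
  by (simp add: free_group_def)

lemma inv_word_carrier:
  assumes "w \<in> carrier (free_group X)"
  shows "inv_word w \<in> carrier (free_group X)"
proof -
  have "set w \<subseteq> X \<times> UNIV" using assms by (auto simp: free_group_carrier)
  then have "set (inv_word w) \<subseteq> X \<times> UNIV" by (auto simp: inv_word_def inv_letter_def)
  then show ?thesis using assms by (auto simp: free_group_carrier reduced_inv_word)
qed

lemma group_free_group: "group (free_group X)"
proof (rule groupI)
  fix u v assume "u \<in> carrier (free_group X)" "v \<in> carrier (free_group X)"
  then show "u \<otimes>\<^bsub>free_group X\<^esub> v \<in> carrier (free_group X)"
    using set_mult_words[of u v]
    by (auto simp: free_group_carrier free_group_mult reduced_mult_words)
next
  fix u assume u: "u \<in> carrier (free_group X)"
  show "\<exists>v\<in>carrier (free_group X). v \<otimes>\<^bsub>free_group X\<^esub> u = \<one>\<^bsub>free_group X\<^esub>"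
    using inv_word_carrier[OF u] inv_word_mult_words[of u]
    by (auto simp: free_group_mult free_group_one)
qed (auto simp: free_group_carrier free_group_mult free_group_one mult_words_assoc)

interpretation F: group "free_group X"
  by (rule group_free_group)

lemma free_group_inv: "w \<in> carrier (free_group X) \<Longrightarrow> inv\<^bsub>free_group X\<^esub> w = inv_word w"
  using inv_word_mult_words[of w] inv_word_carrier[of w]
  by (intro F.inv_equality) (auto simp: free_group_mult free_group_one)

text \<open>As long as the first and the last letter are inverse to each other, conjugation removes both.\<close>

lemma conjugate_cyclically_reduced:
  assumes "w \<in> carrier (free_group X)" "w \<noteq> []"
  obtains c y where "c \<in> carrier (free_group X)" "y \<in> carrier (free_group X)" "y \<noteq> []"
    "hd y \<noteq> inv_letter (last y)" "w \<otimes>\<^bsub>free_group X\<^esub> c = c \<otimes>\<^bsub>free_group X\<^esub> y"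
proof -
  have "\<exists>c y. c \<in> carrier (free_group X) \<and> y \<in> carrier (free_group X) \<and> y \<noteq> [] \<and>
      hd y \<noteq> inv_letter (last y) \<and> w \<otimes>\<^bsub>free_group X\<^esub> c = c \<otimes>\<^bsub>free_group X\<^esub> y"
    using assms
  proof (induction w rule: length_induct)
    case (1 w)
    show ?case
    proof (cases "hd w = inv_letter (last w)")
      case False
      then show ?thesis using 1(2,3) by (intro exI[of _ "[]"] exI[of _ w])
        (auto simp: free_group_carrier free_group_mult mult_words_append)
    next
      case True
      obtain b w1 where w1: "w = w1 @ [b]" using 1(3) by (metis rev_exhaust)
      have "w1 \<noteq> []" using True w1 by auto
      then obtain a v where v: "w1 = a # v" by (metis list.exhaust)
      have b: "b = inv_letter a" using True unfolding w1 v by auto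
      have w: "w = a # v @ [b]" by (simp add: w1 v)
      have red: "reduced w" and letters: "w \<in> lists (X \<times> UNIV)" using 1(2) by (auto simp: free_group_carrier)
      have "v \<noteq> []" using red b by (auto simp: w reduced_Cons)
      have vc: "v \<in> carrier (free_group X)" and ac: "[a] \<in> carrier (free_group X)"
        and bc: "[b] \<in> carrier (free_group X)"
        using red letters by (auto simp: w free_group_carrier reduced_Cons reduced_append)
      have "length v < length w" by (simp add: w)
      from 1(1)[rule_format, OF this vc \<open>v \<noteq> []\<close>] obtain c y where cy: "c \<in> carrier (free_group X)"
        "y \<in> carrier (free_group X)" "y \<noteq> []" "hd y \<noteq> inv_letter (last y)"
        "v \<otimes>\<^bsub>free_group X\<^esub> c = c \<otimes>\<^bsub>free_group X\<^esub> y"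
        by blast
      have "w = [a] \<otimes>\<^bsub>free_group X\<^esub> v \<otimes>\<^bsub>free_group X\<^esub> [b]"
      proof -
        have r1: "reduced ([a] @ v)" and r2: "reduced (([a] @ v) @ [b])"
          using red \<open>v \<noteq> []\<close> by (simp_all add: w reduced_append reduced_Cons)
        show ?thesis
          using mult_words_append[OF r1] mult_words_append[OF r2] by (simp add: free_group_mult w)
      qed
      moreover have "[b] \<otimes>\<^bsub>free_group X\<^esub> [a] = \<one>\<^bsub>free_group X\<^esub>"
        by (simp add: free_group_mult free_group_one b)
      moreover have "[b] \<otimes>\<^bsub>free_group X\<^esub> ([a] \<otimes>\<^bsub>free_group X\<^esub> c) = c"
        using F.m_assoc[OF bc ac cy(1)] calculation(2) cy(1) by simp
      ultimately have "w \<otimes>\<^bsub>free_group X\<^esub> ([a] \<otimes>\<^bsub>free_group X\<^esub> c) = [a] \<otimes>\<^bsub>free_group X\<^esub> (v \<otimes>\<^bsub>free_group X\<^esub> c)"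
        using ac bc vc cy(1) by (simp add: F.m_assoc)
      also have "\<dots> = [a] \<otimes>\<^bsub>free_group X\<^esub> c \<otimes>\<^bsub>free_group X\<^esub> y"
        unfolding cy(5) using ac cy(1,2) by (simp add: F.m_assoc)
      finally show ?thesis using cy ac by blast
    qed
  qed
  then show thesis using that by blast
qed

lemma concat_replicate_pow:
  assumes "concat (replicate n w) \<in> carrier (free_group X)" "w \<in> carrier (free_group X)"
  shows "w [^]\<^bsub>free_group X\<^esub> n = concat (replicate n w)"
  using assms(1)
proof (induction n)
  case (Suc n)
  have eq: "concat (replicate (Suc n) w) = concat (replicate n w) @ w"
    by (simp add: replicate_app_Cons_same flip: concat_append)
       (metis append_Nil2 concat.simps concat_append replicate_Suc replicate_append_same)
  then have "concat (replicate n w) \<in> carrier (free_group X)"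
    using Suc.prems by (auto simp: free_group_carrier reduced_append)
  moreover have "mult_words (concat (replicate n w)) w = concat (replicate n w) @ w"
    using Suc.prems unfolding eq by (intro mult_words_append) (simp add: free_group_carrier)
  ultimately show ?case using Suc.IH eq by (simp add: free_group_mult)
qed (simp add: free_group_one)

text \<open>If \<open>h z\<close> is formed without cancellation, then for reasons of length so is \<open>z h\<close>.
  Hence \<open>z\<close> and \<open>h\<close> commute under concatenation, which makes them powers of a common
  word.\<close>

lemma commuting_words_without_cancellation:
  assumes z: "z \<in> carrier (free_group X)" "z \<noteq> []" and h: "h \<in> carrier (free_group X)"
    and no_cancel: "h = [] \<or> hd z \<noteq> inv_letter (last h)"
    and comm: "z \<otimes>\<^bsub>free_group X\<^esub> h = h \<otimes>\<^bsub>free_group X\<^esub> z"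
  shows "\<exists>m>0. \<exists>n. h [^]\<^bsub>free_group X\<^esub> (m::nat) = z [^]\<^bsub>free_group X\<^esub> (n::nat)"
proof -
  have hz: "h \<otimes>\<^bsub>free_group X\<^esub> z = h @ z"
    unfolding free_group_mult
    using z h no_cancel by (intro mult_words_append) (auto simp: reduced_append free_group_carrier)
  then have "mult_words z h = z @ h"
    using comm by (intro mult_words_eq_append_if_length) (simp add: free_group_mult)
  then have "z @ h = h @ z" using hz comm by (simp add: free_group_mult)
  then obtain m n p where p: "concat (replicate m p) = z" "concat (replicate n p) = h"
    using comm_append_are_replicate by blast
  have m: "m > 0" using p(1) z(2) by (cases m) auto
  then obtain k where "z = p @ concat (replicate k p)" using p(1) by (cases m) auto
  then have pc: "p \<in> carrier (free_group X)" using z(1) by (auto simp: free_group_carrier reduced_append)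
  have "z = p [^]\<^bsub>free_group X\<^esub> m" "h = p [^]\<^bsub>free_group X\<^esub> n"
    using concat_replicate_pow[OF _ pc] p z(1) h by simp_all
  then have "h [^]\<^bsub>free_group X\<^esub> m = z [^]\<^bsub>free_group X\<^esub> n"
    using pc by (simp add: F.nat_pow_pow mult.commute)
  then show ?thesis using m by blast
qed

text \<open>Conjugate \<open>z\<close> to a cyclically reduced word \<open>y\<close>. The last letter of a word
  \<open>k\<close> cannot cancel both the first letter of \<open>y\<close> and the first letter of the inverse
  of \<open>y\<close>, because these two letters are not equal. So \<open>y\<close> or its inverse can be
  multiplied to \<open>k\<close> without cancellation.\<close>

lemma commuting_elements_have_common_power:
  assumes z: "z \<in> carrier (free_group X)" "z \<noteq> []" and h: "h \<in> carrier (free_group X)"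
    and comm: "z \<otimes>\<^bsub>free_group X\<^esub> h = h \<otimes>\<^bsub>free_group X\<^esub> z"
  obtains m n :: nat where "m > 0"
    "h [^]\<^bsub>free_group X\<^esub> m = z [^]\<^bsub>free_group X\<^esub> n \<or>
     h [^]\<^bsub>free_group X\<^esub> m = (inv\<^bsub>free_group X\<^esub> z) [^]\<^bsub>free_group X\<^esub> n"
proof -
  let ?G = "free_group X"
  obtain c y where c: "c \<in> carrier ?G" and y: "y \<in> carrier ?G" "y \<noteq> []"
    and cyc: "hd y \<noteq> inv_letter (last y)" and zc: "z \<otimes>\<^bsub>?G\<^esub> c = c \<otimes>\<^bsub>?G\<^esub> y"
    using conjugate_cyclically_reduced[OF z] .
  define k where "k = inv\<^bsub>?G\<^esub> c \<otimes>\<^bsub>?G\<^esub> h \<otimes>\<^bsub>?G\<^esub> c"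
  have k: "k \<in> carrier ?G" using c h by (simp add: k_def)
  have h_eq: "h = c \<otimes>\<^bsub>?G\<^esub> k \<otimes>\<^bsub>?G\<^esub> inv\<^bsub>?G\<^esub> c"
    using c h by (simp add: k_def F.m_assoc) (simp add: F.m_assoc[symmetric])
  have z_eq: "z = c \<otimes>\<^bsub>?G\<^esub> y \<otimes>\<^bsub>?G\<^esub> inv\<^bsub>?G\<^esub> c"
    using F.inv_solve_right[of z "c \<otimes>\<^bsub>?G\<^esub> y" c] zc z c y by simp
  have y_eq: "y = inv\<^bsub>?G\<^esub> c \<otimes>\<^bsub>?G\<^esub> z \<otimes>\<^bsub>?G\<^esub> c"
    using F.inv_solve_left[of y c "z \<otimes>\<^bsub>?G\<^esub> c"] zc z c y by (simp add: F.m_assoc)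
  have conj_mult: "inv\<^bsub>?G\<^esub> c \<otimes>\<^bsub>?G\<^esub> u \<otimes>\<^bsub>?G\<^esub> c \<otimes>\<^bsub>?G\<^esub> (inv\<^bsub>?G\<^esub> c \<otimes>\<^bsub>?G\<^esub> v \<otimes>\<^bsub>?G\<^esub> c)
      = inv\<^bsub>?G\<^esub> c \<otimes>\<^bsub>?G\<^esub> (u \<otimes>\<^bsub>?G\<^esub> v) \<otimes>\<^bsub>?G\<^esub> c"
    if "u \<in> carrier ?G" "v \<in> carrier ?G" for u v
  proof -
    have "c \<otimes>\<^bsub>?G\<^esub> (inv\<^bsub>?G\<^esub> c \<otimes>\<^bsub>?G\<^esub> (v \<otimes>\<^bsub>?G\<^esub> c)) = v \<otimes>\<^bsub>?G\<^esub> c"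
      using F.m_assoc[of c "inv\<^bsub>?G\<^esub> c" "v \<otimes>\<^bsub>?G\<^esub> c"] that c by simp
    then show ?thesis using that c by (simp add: F.m_assoc)
  qed
  have yk: "y \<otimes>\<^bsub>?G\<^esub> k = k \<otimes>\<^bsub>?G\<^esub> y"
    unfolding y_eq k_def using conj_mult z h comm by simp
  have conj_inv: "inv\<^bsub>?G\<^esub> z = c \<otimes>\<^bsub>?G\<^esub> inv\<^bsub>?G\<^esub> y \<otimes>\<^bsub>?G\<^esub> inv\<^bsub>?G\<^esub> c"
    unfolding z_eq using c y by (simp add: F.inv_mult_group F.m_assoc)
  have "\<exists>m>0. \<exists>n. k [^]\<^bsub>?G\<^esub> m = y [^]\<^bsub>?G\<^esub> (n::nat) \<or> k [^]\<^bsub>?G\<^esub> (m::nat) = (inv\<^bsub>?G\<^esub> y) [^]\<^bsub>?G\<^esub> n"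
  proof (cases "k = [] \<or> hd y \<noteq> inv_letter (last k)")
    case True
    then show ?thesis using commuting_words_without_cancellation[OF y k] yk by blast
  next
    case False
    have inv_y: "inv\<^bsub>?G\<^esub> y = inv_word y" using y(1) by (rule free_group_inv)
    have "hd (inv_word y) = inv_letter (last y)"
      using y(2) by (simp add: inv_word_def hd_rev last_map)
    moreover have "last k = inv_letter (hd y)" using False by simp
    ultimately have "hd (inv_word y) \<noteq> inv_letter (last k)" using cyc by auto
    moreover have "inv_word y \<noteq> []" using y(2) by (simp add: inv_word_def)
    moreover have "inv\<^bsub>?G\<^esub> y \<otimes>\<^bsub>?G\<^esub> k = k \<otimes>\<^bsub>?G\<^esub> inv\<^bsub>?G\<^esub> y"
      using yk y k by (metis F.inv_solve_left F.inv_solve_right F.m_assoc F.m_closed F.inv_closed)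
    ultimately show ?thesis
      using commuting_words_without_cancellation[of "inv_word y" k] inv_word_carrier[OF y(1)] k
      unfolding inv_y by blast
  qed
  then obtain m n :: nat where m: "m > 0"
    and pow: "k [^]\<^bsub>?G\<^esub> m = y [^]\<^bsub>?G\<^esub> n \<or> k [^]\<^bsub>?G\<^esub> m = (inv\<^bsub>?G\<^esub> y) [^]\<^bsub>?G\<^esub> n" by blast
  have "h [^]\<^bsub>?G\<^esub> m = z [^]\<^bsub>?G\<^esub> n \<or> h [^]\<^bsub>?G\<^esub> m = (inv\<^bsub>?G\<^esub> z) [^]\<^bsub>?G\<^esub> n"
    unfolding conj_inv using pow c k y
    by (subst (1 2) h_eq, subst z_eq) (auto simp: F.pow_conjugate)
  then show thesis using that m by blast
qed

end

section \<open>The Magnus expansion\<close>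

text \<open>The product of formal power series. The recursion \<open>conv_Cons\<close> along the first letter of a
  monomial replaces the manipulation of double sums.\<close>

definition conv :: "('x list \<Rightarrow> int) \<Rightarrow> ('x list \<Rightarrow> int) \<Rightarrow> 'x list \<Rightarrow> int" where
  "conv f g w = (\<Sum>i\<le>length w. f (take i w) * g (drop i w))"

lemma conv_Nil [simp]: "conv f g [] = f [] * g []"
  by (simp add: conv_def)

lemma conv_Cons: "conv f g (x # w) = f [] * g (x # w) + conv (\<lambda>u. f (x # u)) g w"
  by (simp add: conv_def sum.atMost_Suc_shift del: sum.atMost_Suc)

lemma conv_linear_left: "conv (\<lambda>u. c * f u + g u) h w = c * conv f h w + conv g h w"
  by (simp add: conv_def sum.distrib sum_distrib_left algebra_simps)

lemma conv_zero_left [simp]: "conv (\<lambda>u. 0) g w = 0"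
  by (simp add: conv_def)

lemma conv_diff_right: "conv f (\<lambda>u. g u - h u) w = conv f g w - conv f h w"
  by (simp add: conv_def sum_subtractf algebra_simps)

lemma conv_diff_left: "conv (\<lambda>u. g u - h u) f w = conv g f w - conv h f w"
  by (simp add: conv_def sum_subtractf algebra_simps)

lemma conv_assoc: "conv (conv f g) h = conv f (conv g h)"
proof
  fix w show "conv (conv f g) h w = conv f (conv g h) w"
  proof (induction w arbitrary: f g)
    case (Cons x w)
    have "conv (conv f g) h (x # w) = f [] * g [] * h (x # w)
        + conv (\<lambda>u. f [] * g (x # u) + conv (\<lambda>u. f (x # u)) g u) h w"
      by (simp add: conv_Cons)
    also have "\<dots> = f [] * g [] * h (x # w) + f [] * conv (\<lambda>u. g (x # u)) h w
        + conv (conv (\<lambda>u. f (x # u)) g) h w"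
      by (simp add: conv_linear_left)
    also have "\<dots> = conv f (conv g h) (x # w)"
      unfolding Cons.IH by (simp add: conv_Cons algebra_simps)
    finally show ?case .
  qed (simp add: mult.assoc)
qed

definition one_series :: "'x list \<Rightarrow> int" where
  "one_series w = (if w = [] then 1 else 0)"

lemma conv_one_left: "conv one_series g = g"
proof
  fix w show "conv one_series g w = g w"
    by (cases w) (simp_all add: one_series_def conv_Cons)
qed

lemma conv_one_right: "conv f one_series = f"
proof
  fix w show "conv f one_series w = f w"
    by (induction w arbitrary: f) (simp_all add: one_series_def conv_Cons)
qed

lemma conv_nonzeroE:
  assumes "conv f g w \<noteq> 0"
  obtains i where "i \<le> length w" "f (take i w) \<noteq> 0" "g (drop i w) \<noteq> 0"
proof -
  obtain i where "i \<in> {..length w}" "f (take i w) * g (drop i w) \<noteq> 0"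
    using assms unfolding conv_def by (rule sum.not_neutral_contains_not_neutral)
  then show ?thesis using that by auto
qed

lemma conv_lists: "conv f g w \<noteq> 0 \<Longrightarrow> (\<And>w. f w \<noteq> 0 \<Longrightarrow> w \<in> lists X) \<Longrightarrow>
    (\<And>w. g w \<noteq> 0 \<Longrightarrow> w \<in> lists X) \<Longrightarrow> w \<in> lists X"
  by (metis append_in_lists_conv append_take_drop_id conv_nonzeroE)

context
  fixes X :: "'x set"
begin

lemma nc_carrier: "f \<in> carrier (nc_series X) \<longleftrightarrow> (\<forall>w. f w \<noteq> 0 \<longrightarrow> w \<in> lists X)"
  by (simp add: nc_series_def)

lemma nc_mult: "f \<otimes>\<^bsub>nc_series X\<^esub> g = conv f g"
  by (auto simp: nc_series_def conv_def)

lemma nc_one: "\<one>\<^bsub>nc_series X\<^esub> = one_series"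
  by (auto simp: nc_series_def one_series_def)

lemma monoid_nc_series: "monoid (nc_series X)"
proof (rule monoidI)
  show "f \<otimes>\<^bsub>nc_series X\<^esub> g \<in> carrier (nc_series X)"
    if "f \<in> carrier (nc_series X)" "g \<in> carrier (nc_series X)" for f g
    unfolding nc_carrier nc_mult
  proof (intro allI impI)
    fix w assume "conv f g w \<noteq> 0"
    then show "w \<in> lists X" by (rule conv_lists) (use that in \<open>auto simp: nc_carrier\<close>)
  qed
qed (simp_all add: nc_carrier nc_mult nc_one conv_assoc conv_one_left conv_one_right one_series_def)

interpretation S: monoid "nc_series X"
  by (rule monoid_nc_series)

definition one_plus :: "'x \<Rightarrow> 'x list \<Rightarrow> int" where
  "one_plus x = (\<lambda>w. one_series w + indet x w)"

lemma one_plus_eq: "\<one>\<^bsub>nc_series X\<^esub> \<oplus>\<^bsub>nc_series X\<^esub> indet x = one_plus x"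
  by (simp add: nc_one one_plus_def) (simp add: nc_series_def)

lemma one_plus_Nil [simp]: "one_plus x [] = 1"
  by (simp add: one_plus_def one_series_def indet_def)

lemma conv_one_plus_Cons: "conv (one_plus x) f (y # w) = f (y # w) + (if y = x then f w else 0)"
proof -
  have "(\<lambda>u. one_plus x (y # u)) = (if y = x then one_series else (\<lambda>u. 0))"
    by (auto simp: one_plus_def one_series_def indet_def)
  then show ?thesis
    by (simp add: conv_Cons conv_one_left)
qed

lemma one_plus_cancel:
  assumes "conv (one_plus x) f = conv (one_plus x) g"
  shows "f = g"
proof
  fix w show "f w = g w"
  proof (induction w)
    case Nil then show ?case using fun_cong[OF assms, of "[]"] by simp
  next
    case (Cons y w)
    then show ?case using fun_cong[OF assms, of "y # w"]
      by (auto simp: conv_one_plus_Cons split: if_splits)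
  qed
qed

text \<open>The inverse of \<open>1 + t\<close> is the geometric series of \<open>- t\<close>. Since \<open>1 + t\<close>
  can be cancelled on the left, its right inverse is also a left inverse.\<close>

lemma one_plus_Units:
  assumes "x \<in> X"
  shows "one_plus x \<in> Units (nc_series X)"
proof -
  define g :: "'x list \<Rightarrow> int" where "g w = (if set w \<subseteq> {x} then (- 1) ^ length w else 0)" for w
  have right: "conv (one_plus x) g = one_series"
  proof
    fix w show "conv (one_plus x) g w = one_series w"
      by (cases w) (auto simp: conv_one_plus_Cons g_def one_series_def)
  qed
  have "conv (one_plus x) (conv g (one_plus x)) = conv (one_plus x) one_series"
    using right by (simp add: conv_one_left conv_one_right flip: conv_assoc)
  then have "conv g (one_plus x) = one_series" by (rule one_plus_cancel)
  moreover have "g \<in> carrier (nc_series X)" "one_plus x \<in> carrier (nc_series X)"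
    using assms by (auto simp: nc_carrier g_def one_plus_def one_series_def indet_def split: if_splits)
  ultimately show ?thesis
    using right by (auto simp: Units_def nc_mult nc_one)
qed

lemma magnus_letter_eq: "magnus_letter X (x, s) = (if s then one_plus x else inv\<^bsub>nc_series X\<^esub> one_plus x)"
  by (simp add: magnus_letter_def one_plus_eq Let_def)

lemma magnus_letter_carrier: "a \<in> X \<times> UNIV \<Longrightarrow> magnus_letter X a \<in> carrier (nc_series X)"
  using one_plus_Units by (cases a) (auto simp: magnus_letter_eq intro: S.Units_closed)

lemma magnus_letter_inv:
  "a \<in> X \<times> UNIV \<Longrightarrow> conv (magnus_letter X a) (magnus_letter X (inv_letter a)) = one_series"
  using one_plus_Units S.Units_r_inv S.Units_l_inv
  by (cases a) (auto simp: magnus_letter_eq inv_letter_def simp flip: nc_mult nc_one)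

lemma magnus_Nil: "magnus X [] = one_series"
  by (simp add: magnus_def nc_one)

lemma magnus_Cons: "magnus X (a # w) = conv (magnus_letter X a) (magnus X w)"
  by (simp add: magnus_def nc_mult)

lemma magnus_carrier: "w \<in> lists (X \<times> UNIV) \<Longrightarrow> magnus X w \<in> carrier (nc_series X)"
proof (induction w)
  case Nil then show ?case using S.one_closed by (simp add: magnus_Nil nc_one)
next
  case (Cons a w)
  then show ?case
    using S.m_closed[OF magnus_letter_carrier[of a] Cons.IH] by (simp add: magnus_Cons nc_mult)
qed

lemma magnus_Cons_inverse:
  assumes "x \<in> X"
  shows "conv (one_plus x) (magnus X ((x, False) # w)) = magnus X w"
proof -
  have "conv (one_plus x) (magnus_letter X (x, False)) = one_series"
    using magnus_letter_inv[of "(x, True)"] assms by (simp add: magnus_letter_eq inv_letter_def)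
  then show ?thesis
    unfolding magnus_Cons by (simp add: conv_one_left flip: conv_assoc)
qed

lemma magnus_at_Nil: "w \<in> lists (X \<times> UNIV) \<Longrightarrow> magnus X w [] = 1"
proof (induction w)
  case (Cons a w)
  obtain x s where a: "a = (x, s)" by (cases a)
  then have x: "x \<in> X" and IH: "magnus X w [] = 1" using Cons by auto
  show ?case
  proof (cases s)
    case True
    then show ?thesis using IH by (simp add: a magnus_Cons magnus_letter_eq one_plus_def one_series_def indet_def)
  next
    case False
    then show ?thesis
      using fun_cong[OF magnus_Cons_inverse[OF x, of w], of "[]"] IH by (simp add: a)
  qed
qed (simp add: magnus_Nil one_series_def)

lemma magnus_supp_letters:
  "w \<in> lists (X \<times> UNIV) \<Longrightarrow> magnus X w m \<noteq> 0 \<Longrightarrow> set m \<subseteq> fst ` set w"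
proof (induction w arbitrary: m)
  case Nil then show ?case by (auto simp: magnus_Nil one_series_def split: if_splits)
next
  case (Cons a w)
  obtain x s where a: "a = (x, s)" by (cases a)
  then have x: "x \<in> X" and IH: "magnus X w m \<noteq> 0 \<Longrightarrow> set m \<subseteq> fst ` set w" for m
    using Cons by auto
  show ?case
  proof (cases s)
    case True
    then have "magnus X (a # w) = conv (one_plus x) (magnus X w)"
      by (simp add: a magnus_Cons magnus_letter_eq)
    then have "m = [] \<or> magnus X w m \<noteq> 0 \<or> (\<exists>u. m = x # u \<and> magnus X w u \<noteq> 0)"
      using Cons.prems(2) by (cases m) (auto simp: conv_one_plus_Cons split: if_splits)
    then show ?thesis using IH by (fastforce simp: a)
  next
    case False
    have rec: "magnus X w (y # u) = magnus X (a # w) (y # u) + (if y = x then magnus X (a # w) u else 0)" for y u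
      using fun_cong[OF magnus_Cons_inverse[OF x, of w], of "y # u"] False by (auto simp: a conv_one_plus_Cons)
    show ?thesis
      using Cons.prems(2)
    proof (induction m)
      case (Cons y u)
      then consider "magnus X w (y # u) \<noteq> 0" | "y = x" "magnus X (a # w) u \<noteq> 0"
        using rec[of y u] Cons.prems by (cases "y = x \<and> magnus X (a # w) u \<noteq> 0") (auto split: if_splits)
      then show ?case
      proof cases
        case 1 then show ?thesis using IH by fastforce
      next
        case 2 then show ?thesis using Cons.IH by (auto simp: a)
      qed
    qed simp
  qed
qed

lemma magnus_cons_reduce:
  assumes "a \<in> X \<times> UNIV" "v \<in> lists (X \<times> UNIV)"
  shows "magnus X (cons_reduce a v) = conv (magnus_letter X a) (magnus X v)"
proof (cases v)
  case (Cons b v')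
  have "conv (magnus_letter X a) (conv (magnus_letter X (inv_letter a)) (magnus X v')) = magnus X v'"
    using magnus_letter_inv[OF assms(1)]
    by (simp add: conv_one_left flip: conv_assoc)
  then show ?thesis by (simp add: Cons magnus_Cons)
qed (simp add: magnus_Cons)

lemma magnus_mult_words:
  assumes "u \<in> lists (X \<times> UNIV)" "v \<in> lists (X \<times> UNIV)"
  shows "magnus X (mult_words u v) = conv (magnus X u) (magnus X v)"
  using assms(1)
proof (induction u rule: list.induct)
  case Nil then show ?case by (simp add: magnus_Nil conv_one_left)
next
  case (Cons a u)
  have "mult_words u v \<in> lists (X \<times> UNIV)"
    using set_mult_words[of u v] Cons.prems assms(2) by auto
  then show ?case using Cons magnus_cons_reduce[of a "mult_words u v"]
    by (auto simp: magnus_Cons conv_assoc)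
qed

definition letter_sign :: "bool \<Rightarrow> int" where
  "letter_sign s = (if s then 1 else - 1)"

text \<open>Letters act on the expansion by \<open>(1 + t)\<^sup>\<plusminus>\<^sup>1\<close>. On monomials that begin
  with at most one \<open>t\<close>, these two factors act like \<open>1 + t\<close> and \<open>1 - t\<close>;
  this and the next lemma make that precise.\<close>

lemma magnus_Cons_other:
  assumes "x \<in> X" "m = [] \<or> hd m \<noteq> x" and w: "w \<in> lists (X \<times> UNIV)"
  shows "magnus X ((x, s) # w) m = magnus X w m"
proof (cases m)
  case Nil then show ?thesis using assms magnus_at_Nil[of w] magnus_at_Nil[of "(x, s) # w"] by auto
next
  case (Cons y u)
  then show ?thesis
    using fun_cong[OF magnus_Cons_inverse[OF assms(1), of w], of m] assms(2)
    by (cases s) (auto simp: conv_one_plus_Cons magnus_Cons magnus_letter_eq)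
qed

lemma magnus_Cons_same:
  assumes "x \<in> X" "m = [] \<or> hd m \<noteq> x" and w: "w \<in> lists (X \<times> UNIV)"
  shows "magnus X ((x, s) # w) (x # m) = magnus X w (x # m) + letter_sign s * magnus X w m"
  using fun_cong[OF magnus_Cons_inverse[OF assms(1), of w], of "x # m"] magnus_Cons_other[OF assms]
  by (cases s) (auto simp: conv_one_plus_Cons magnus_Cons[of "(x, True)"] magnus_letter_eq letter_sign_def)

text \<open>In the expansion of a product of powers of letters, each power contributes at most one letter to a monomial
  without equal neighbours.\<close>

lemma magnus_distinct_adj_subseq:
  assumes "w \<in> lists (X \<times> UNIV)" "distinct_adj m" "magnus X w m \<noteq> 0"
  shows "subseq m (remdups_adj (map fst w))"
  using assms
proof (induction w arbitrary: m rule: list.induct)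
  case Nil then show ?case by (auto simp: magnus_Nil one_series_def split: if_splits)
next
  case (Cons a w)
  obtain x s where a: "a = (x, s)" by (cases a)
  have x: "x \<in> X" and w: "w \<in> lists (X \<times> UNIV)" using Cons.prems(1) a by auto
  let ?\<rho> = "remdups_adj (map fst w)" and ?\<rho>' = "remdups_adj (map fst (a # w))"
  have \<rho>: "?\<rho>' = (if ?\<rho> \<noteq> [] \<and> hd ?\<rho> = x then ?\<rho> else x # ?\<rho>)"
    by (cases "?\<rho>") (auto simp: a remdups_adj_Cons)
  have sub: "subseq ?\<rho> ?\<rho>'" unfolding \<rho> by auto
  show ?case
  proof (cases "m = [] \<or> hd m \<noteq> x")
    case True
    then have "magnus X w m \<noteq> 0" using magnus_Cons_other[OF x _ w] Cons.prems(3) a by simp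
    then show ?thesis using Cons.IH[OF w Cons.prems(2)] sub by (meson subseq_order.order_trans)
  next
    case False
    then obtain u where m: "m = x # u" by (cases m) auto
    have u: "distinct_adj u" "u = [] \<or> hd u \<noteq> x"
      using Cons.prems(2) unfolding m by (cases u; auto)+
    consider "magnus X w m \<noteq> 0" | "magnus X w u \<noteq> 0"
      using magnus_Cons_same[OF x u(2) w, of s] Cons.prems(3) unfolding a m
      by (cases "magnus X w u = 0") auto
    then show ?thesis
    proof cases
      case 1 then show ?thesis using Cons.IH[OF w Cons.prems(2)] sub by (meson subseq_order.order_trans)
    next
      case 2
      then have su: "subseq u ?\<rho>" using Cons.IH[OF w u(1)] by blast
      show ?thesis
      proof (cases "?\<rho> \<noteq> [] \<and> hd ?\<rho> = x")
        case True
        then obtain \<sigma> where \<sigma>: "?\<rho> = x # \<sigma>" by (cases "?\<rho>") auto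
        have "subseq u \<sigma>" using su u(2) unfolding \<sigma> by (cases u) auto
        then show ?thesis unfolding \<rho> using True unfolding \<sigma> m by simp
      next
        case False
        then have "?\<rho>' = x # ?\<rho>" using \<rho> by argo
        then show ?thesis using su by (simp add: m)
      qed
    qed
  qed
qed

text \<open>The classical argument for injectivity: if the reduced word is a product of nonzero powers of letters,
  consecutive letters being distinct, then the coefficient of the product of these indeterminates is the product
  of the exponents. Here \<open>k\<close> is the absolute value of the first exponent, and the coefficient at
  \<open>\<rho>\<close> is the product of the other exponents.\<close>

lemma magnus_leading_coefficient:
  assumes "w \<in> lists (X \<times> UNIV)" "reduced w" "w = (x, s) # v" "remdups_adj (map fst w) = x # \<rho>"
  shows "\<exists>k>0. magnus X w (x # \<rho>) = letter_sign s * k * magnus X w \<rho> \<and> magnus X w \<rho> \<noteq> 0"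
  using assms
proof (induction w arbitrary: x s v \<rho> rule: list.induct)
  case (Cons a w)
  have a: "a = (x, s)" and v: "v = w" and x: "x \<in> X" and w: "w \<in> lists (X \<times> UNIV)" and red: "reduced w"
    using Cons.prems by (auto simp: reduced_Cons)
  show ?case
  proof (cases w)
    case Nil
    then have "\<rho> = []" using Cons.prems(4) by simp
    then show ?thesis using Nil magnus_Cons_same[OF x _ w, of "[]" s] magnus_at_Nil[OF Cons.prems(1)]
      by (intro exI[of _ 1]) (auto simp: a magnus_Nil one_series_def)
  next
    case w': (Cons b w'')
    obtain y s' where b: "b = (y, s')" by (cases b)
    obtain \<rho>' where \<rho>': "remdups_adj (map fst w) = y # \<rho>'"
      by (rule that[of "tl (remdups_adj (map fst w))"]) (simp add: w' b)
    obtain k where k: "k > 0" "magnus X w (y # \<rho>') = letter_sign s' * k * magnus X w \<rho>'" "magnus X w \<rho>' \<noteq> 0"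
      using Cons.IH[OF w red _ \<rho>'] w' b by blast
    show ?thesis
    proof (cases "y = x")
      case True
      have "s' = s" using Cons.prems(2) unfolding a w' b True by (auto simp: reduced_Cons inv_letter_def)
      have "\<rho> = \<rho>'" using Cons.prems(4) \<rho>' by (simp add: a True remdups_adj_Cons)
      have "distinct_adj (x # \<rho>')" using distinct_adj_remdups_adj[of "map fst w"] unfolding \<rho>' True .
      then have hd: "\<rho>' = [] \<or> hd \<rho>' \<noteq> x" by (cases \<rho>') auto
      show ?thesis
        using k magnus_Cons_same[OF x hd w, of s] magnus_Cons_other[OF x hd w, of s]
        unfolding \<open>\<rho> = \<rho>'\<close> \<open>s' = s\<close> True a
        by (intro exI[of _ "k + 1"]) (auto simp: algebra_simps)
    next
      case False
      have \<rho>: "\<rho> = y # \<rho>'" using Cons.prems(4) \<rho>' False by (simp add: a remdups_adj_Cons)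
      have hd: "\<rho> = [] \<or> hd \<rho> \<noteq> x" using False by (simp add: \<rho>)
      have "distinct_adj (x # \<rho>)" using distinct_adj_remdups_adj[of "map fst (a # w)"] unfolding Cons.prems(4) .
      moreover have "\<not> subseq (x # \<rho>) (remdups_adj (map fst w))"
        unfolding \<rho>' \<rho>[symmetric] using list_emb_length[of "(=)" "x # \<rho>" \<rho>] by auto
      ultimately have zero: "magnus X w (x # \<rho>) = 0" using magnus_distinct_adj_subseq[OF w] by blast
      have "letter_sign s' \<noteq> 0" by (simp add: letter_sign_def)
      then have "magnus X w \<rho> \<noteq> 0" using k by (simp add: \<rho>)
      then show ?thesis
        using magnus_Cons_same[OF x hd w, of s] magnus_Cons_other[OF x hd w, of s] zero
        by (intro exI[of _ 1]) (simp add: a)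
    qed
  qed
qed simp

lemma magnus_kernel:
  assumes "w \<in> carrier (free_group X)" "magnus X w = one_series"
  shows "w = []"
proof (rule ccontr)
  assume "w \<noteq> []"
  then obtain x s v where w: "w = (x, s) # v" by (metis list.exhaust surj_pair)
  obtain \<rho> where \<rho>: "remdups_adj (map fst w) = x # \<rho>"
    by (rule that[of "tl (remdups_adj (map fst w))"]) (simp add: w)
  obtain k where "k > 0" "magnus X w (x # \<rho>) = letter_sign s * k * magnus X w \<rho>" "magnus X w \<rho> \<noteq> 0"
    using magnus_leading_coefficient[OF _ _ w \<rho>] assms(1) by (auto simp: free_group_carrier)
  then have "magnus X w (x # \<rho>) \<noteq> 0" by (auto simp: letter_sign_def)
  then show False using assms(2) by (simp add: one_series_def)
qed

interpretation F: group "free_group X"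
  by (rule group_free_group)

lemma magnus_mult:
  assumes "g \<in> carrier (free_group X)" "h \<in> carrier (free_group X)"
  shows "magnus X (g \<otimes>\<^bsub>free_group X\<^esub> h) = conv (magnus X g) (magnus X h)"
  using assms magnus_mult_words[of g h] by (simp add: free_group_mult free_group_carrier)

lemma magnus_inj:
  assumes g: "g \<in> carrier (free_group X)" and h: "h \<in> carrier (free_group X)"
    and eq: "magnus X g = magnus X h"
  shows "g = h"
proof -
  let ?G = "free_group X"
  have "magnus X (inv\<^bsub>?G\<^esub> g \<otimes>\<^bsub>?G\<^esub> h) = magnus X (inv\<^bsub>?G\<^esub> g \<otimes>\<^bsub>?G\<^esub> g)"
    using magnus_mult[OF F.inv_closed[OF g] g] magnus_mult[OF F.inv_closed[OF g] h] eq by metis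
  also have "\<dots> = one_series" using g by (simp add: free_group_one magnus_Nil)
  finally have "inv\<^bsub>?G\<^esub> g \<otimes>\<^bsub>?G\<^esub> h = \<one>\<^bsub>?G\<^esub>"
    using magnus_kernel[of "inv\<^bsub>?G\<^esub> g \<otimes>\<^bsub>?G\<^esub> h"] g h by (simp add: free_group_one)
  then show ?thesis using F.inv_solve_left'[OF F.one_closed g h] g by simp
qed

end

section \<open>The Magnus order and centralizers in the free group\<close>

lemma lenlex_total_on_lists:
  assumes "total_on X s" "u \<in> lists X" "v \<in> lists X" "u \<noteq> v"
  shows "(u, v) \<in> lenlex s \<or> (v, u) \<in> lenlex s"
  using assms(2-4)
proof (induction u arbitrary: v rule: list.induct)
  case (Cons x u)
  show ?case
  proof (cases v)
    case v: (Cons y v')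
    consider "length u < length v'" | "length v' < length u" | "length u = length v'" "x \<noteq> y" | "x = y"
      by linarith
    then show ?thesis
    proof cases
      case 3
      then show ?thesis using assms(1) Cons.prems unfolding v
        by (auto simp: Cons_lenlex_iff total_on_def)
    next
      case 4
      then show ?thesis using Cons.IH[of v'] Cons.prems unfolding v by (auto simp: Cons_lenlex_iff)
    qed (auto simp: v Cons_lenlex_iff)
  qed simp
qed simp

lemma finite_has_least:
  assumes "finite S" "S \<noteq> {}" "trans L"
    and "\<And>u v. u \<in> S \<Longrightarrow> v \<in> S \<Longrightarrow> u \<noteq> v \<Longrightarrow> (u, v) \<in> L \<or> (v, u) \<in> L"
  shows "\<exists>m\<in>S. \<forall>v\<in>S. v = m \<or> (m, v) \<in> L"
  using assms(1,2,4)
proof (induction S rule: finite_ne_induct)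
  case (insert a S)
  then obtain m where m: "m \<in> S" "\<forall>v\<in>S. v = m \<or> (m, v) \<in> L" by blast
  have "m \<noteq> a" using m(1) insert.hyps by auto
  then consider "(a, m) \<in> L" | "(m, a) \<in> L" using insert.prems[of a m] m(1) by auto
  then show ?case
  proof cases
    case 1
    then have "\<forall>v\<in>S. (a, v) \<in> L" using m(2) assms(3) by (metis transD)
    then show ?thesis by auto
  next
    case 2 then show ?thesis using m by auto
  qed
qed simp

text \<open>On monomials up to the lowest degree of \<open>g - 1\<close>, multiplication of series with constant term
  \<open>1\<close> is addition of coefficients.\<close>

lemma conv_at_short:
  assumes "g [] = 1" "\<And>v. v \<noteq> [] \<Longrightarrow> length v < d \<Longrightarrow> g v = 0" "f [] = 1"
    and u: "u \<noteq> []" "length u \<le> d"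
  shows "conv f g u = f u + g u" "conv g f u = f u + g u"
proof -
  have ends: "(\<Sum>i\<le>length u. F i) = F 0 + F (length u)"
    if "\<And>i. 0 < i \<Longrightarrow> i < length u \<Longrightarrow> F i = 0" for F :: "nat \<Rightarrow> int"
  proof -
    have "(\<Sum>i\<le>length u. F i) = (\<Sum>i\<in>{0, length u}. F i)"
      by (rule sum.mono_neutral_right) (use that in auto)
    then show ?thesis using u(1) by simp
  qed
  have "g (drop i u) = 0" "g (take i u) = 0" if "0 < i" "i < length u" for i
    using assms(2)[of "drop i u"] assms(2)[of "take i u"] that u by auto
  then show "conv f g u = f u + g u" "conv g f u = f u + g u"
    unfolding conv_def using ends[of "\<lambda>i. f (take i u) * g (drop i u)"]
      ends[of "\<lambda>i. g (take i u) * f (drop i u)"] assms(1,3) by simp_all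
qed

locale magnus_ordered =
  fixes X :: "'x set" and r :: "'x rel"
  assumes linear: "linear_order_on X r"
begin

abbreviation "L \<equiv> lenlex (r - Id)"
abbreviation "G \<equiv> free_group X"

sublocale F: group G
  by (rule group_free_group)

lemma L_trans: "trans L"
  using linear by (intro lenlex_transI trans_diff_Id) (auto simp: order_on_defs)

lemma L_irrefl: "(m, m) \<notin> L"
  by (intro lenlex_irreflexive) auto

lemma L_asym: "(m, m') \<in> L \<Longrightarrow> (m', m) \<notin> L"
  using L_trans L_irrefl by (metis transD)

lemma L_total: "m \<in> lists X \<Longrightarrow> m' \<in> lists X \<Longrightarrow> m = m' \<or> (m, m') \<in> L \<or> (m', m) \<in> L"
  using lenlex_total_on_lists[of X "r - Id" m m'] linear
  by (auto simp: order_on_defs total_on_def)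

lemma L_length: "length m < length m' \<Longrightarrow> (m, m') \<in> L"
  by (simp add: lenlex_conv)

text \<open>The positive elements of the Magnus order are those whose expansion minus \<open>1\<close> has a positive
  coefficient at its least monomial.\<close>

definition least_monomial :: "('x list \<Rightarrow> int) \<Rightarrow> 'x list \<Rightarrow> bool" where
  "least_monomial f m \<longleftrightarrow> f m \<noteq> 0 \<and> (\<forall>m'. f m' \<noteq> 0 \<longrightarrow> m' = m \<or> (m, m') \<in> L)"

definition magnus_diff :: "'x letter list \<Rightarrow> 'x letter list \<Rightarrow> 'x list \<Rightarrow> int" where
  "magnus_diff g h = (\<lambda>m. magnus X h m - magnus X g m)"

lemma magnus_less_iff:
  "magnus_less X r g h \<longleftrightarrow> (\<exists>m. least_monomial (magnus_diff g h) m \<and> magnus_diff g h m > 0)"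
  unfolding magnus_less_def least_monomial_def magnus_diff_def by (metis less_numeral_extra(3))

lemma least_monomial_unique: "least_monomial f m \<Longrightarrow> least_monomial f m' \<Longrightarrow> m = m'"
  unfolding least_monomial_def using L_asym by blast

lemma magnus_diff_lists:
  assumes "g \<in> carrier G" "h \<in> carrier G" "magnus_diff g h m \<noteq> 0"
  shows "m \<in> lists X"
proof -
  have "magnus X g m \<noteq> 0 \<or> magnus X h m \<noteq> 0" using assms(3) by (auto simp: magnus_diff_def)
  then show ?thesis
    using magnus_carrier[of g X] magnus_carrier[of h X] assms(1,2)
    unfolding free_group_carrier nc_carrier by blast
qed

text \<open>The order on monomials need not be well-founded when there are infinitely many letters. But only finitely many
  letters occur in \<open>g\<close> and \<open>h\<close>, hence only finitely many monomials of a given degree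
  occur in their expansions.\<close>

lemma least_monomial_exists:
  assumes g: "g \<in> carrier G" and h: "h \<in> carrier G" and "g \<noteq> h"
  obtains m where "least_monomial (magnus_diff g h) m"
proof -
  define N where "N = {m. magnus_diff g h m \<noteq> 0}"
  have "magnus X g \<noteq> magnus X h" using magnus_inj[OF g h] assms(3) by blast
  then obtain w where "magnus X h w \<noteq> magnus X g w" by (metis ext)
  then have "N \<noteq> {}" by (auto simp: N_def magnus_diff_def)
  then obtain m0 where m0: "m0 \<in> N" "\<And>m. m \<in> N \<Longrightarrow> length m0 \<le> length m"
    using arg_min_nat_lemma[of "\<lambda>m. m \<in> N" _ length] by blast
  \<comment> \<open>The monomials of least degree suffice, since the degree is compared first.\<close>
  define S where "S = {m \<in> N. length m = length m0}"
  have "S \<subseteq> {m. set m \<subseteq> fst ` (set g \<union> set h) \<and> length m = length m0}"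
  proof
    fix m assume m: "m \<in> S"
    then have "magnus X g m \<noteq> 0 \<or> magnus X h m \<noteq> 0" by (auto simp: S_def N_def magnus_diff_def)
    then have "set m \<subseteq> fst ` (set g \<union> set h)"
      using magnus_supp_letters[of g X m] magnus_supp_letters[of h X m] g h
      by (auto simp: free_group_carrier)
    then show "m \<in> {m. set m \<subseteq> fst ` (set g \<union> set h) \<and> length m = length m0}"
      using m by (simp add: S_def)
  qed
  then have "finite S" by (rule finite_subset) (simp add: finite_lists_length_eq)
  moreover have "S \<noteq> {}" using m0(1) by (auto simp: S_def)
  moreover have "(u, v) \<in> L \<or> (v, u) \<in> L" if "u \<in> S" "v \<in> S" "u \<noteq> v" for u v
    using L_total[of u v] magnus_diff_lists[OF g h] that by (auto simp: S_def N_def)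
  ultimately obtain m where m: "m \<in> S" "\<forall>v\<in>S. v = m \<or> (m, v) \<in> L"
    using finite_has_least[OF _ _ L_trans, of S] by blast
  have "m' = m \<or> (m, m') \<in> L" if "magnus_diff g h m' \<noteq> 0" for m'
  proof (cases "m' \<in> S")
    case False
    then have "length m0 < length m'" using that m0(2)[of m'] by (auto simp: S_def N_def)
    then show ?thesis using m(1) by (auto simp: S_def intro: L_length)
  qed (use m in blast)
  then show thesis using m(1) by (intro that[of m]) (auto simp: least_monomial_def S_def N_def)
qed

lemma magnus_less_linear:
  assumes "g \<in> carrier G" "h \<in> carrier G" "g \<noteq> h"
  shows "magnus_less X r g h \<or> magnus_less X r h g"
proof -
  obtain m where m: "least_monomial (magnus_diff g h) m" using least_monomial_exists[OF assms] .
  have eq: "magnus_diff h g m' = - magnus_diff g h m'" for m' by (simp add: magnus_diff_def)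
  have "least_monomial (magnus_diff h g) m" using m by (simp add: least_monomial_def eq)
  moreover have "magnus_diff g h m > 0 \<or> magnus_diff h g m > 0" using m by (auto simp: least_monomial_def eq)
  ultimately show ?thesis using m magnus_less_iff by blast
qed

lemma magnus_less_asym: "magnus_less X r g h \<Longrightarrow> \<not> magnus_less X r h g"
proof
  assume "magnus_less X r g h" "magnus_less X r h g"
  then obtain m m' where m: "least_monomial (magnus_diff g h) m" "magnus_diff g h m > 0"
    and m': "least_monomial (magnus_diff h g) m'" "magnus_diff h g m' > 0" using magnus_less_iff by blast
  have eq: "magnus_diff h g u = - magnus_diff g h u" for u by (simp add: magnus_diff_def)
  have "least_monomial (magnus_diff g h) m'" using m'(1) by (simp add: least_monomial_def eq)
  then have "m = m'" using m(1) by (intro least_monomial_unique)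
  then show False using m(2) m'(2) eq by simp
qed

lemma magnus_less_trans:
  assumes car: "g \<in> carrier G" "h \<in> carrier G" "k \<in> carrier G"
    and less: "magnus_less X r g h" "magnus_less X r h k"
  shows "magnus_less X r g k"
proof -
  obtain m1 where m1: "magnus_diff g h m1 > 0" "\<And>u. magnus_diff g h u \<noteq> 0 \<Longrightarrow> u = m1 \<or> (m1, u) \<in> L"
    using less(1) unfolding magnus_less_iff least_monomial_def by blast
  obtain m2 where m2: "magnus_diff h k m2 > 0" "\<And>u. magnus_diff h k u \<noteq> 0 \<Longrightarrow> u = m2 \<or> (m2, u) \<in> L"
    using less(2) unfolding magnus_less_iff least_monomial_def by blast
  have eq: "magnus_diff g k u = magnus_diff g h u + magnus_diff h k u" for u by (simp add: magnus_diff_def)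
  have lists: "m1 \<in> lists X" "m2 \<in> lists X"
    using magnus_diff_lists[OF car(1,2), of m1] magnus_diff_lists[OF car(2,3), of m2] m1(1) m2(1) by auto
  have sum_nz: "magnus_diff g h u \<noteq> 0 \<or> magnus_diff h k u \<noteq> 0" if "magnus_diff g k u \<noteq> 0" for u
    using that eq[of u] by auto
  consider "m1 = m2" | "(m1, m2) \<in> L" | "(m2, m1) \<in> L" using L_total[OF lists] by blast
  then have "\<exists>m. magnus_diff g k m > 0 \<and> (\<forall>u. magnus_diff g k u \<noteq> 0 \<longrightarrow> u = m \<or> (m, u) \<in> L)"
  proof cases
    case 1
    then show ?thesis using m1 m2 sum_nz eq[of m1] by (intro exI[of _ m1]) auto
  next
    case 2
    then have "magnus_diff h k m1 = 0" using m2(2)[of m1] L_asym L_irrefl by blast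
    then show ?thesis using m1 m2(2) sum_nz 2 eq[of m1] transD[OF L_trans]
      by (intro exI[of _ m1]) (simp, blast)
  next
    case 3
    then have "magnus_diff g h m2 = 0" using m1(2)[of m2] L_asym L_irrefl by blast
    then show ?thesis using m2 m1(2) sum_nz 3 eq[of m2] transD[OF L_trans]
      by (intro exI[of _ m2]) (simp, blast)
  qed
  then show ?thesis unfolding magnus_less_iff least_monomial_def by (metis less_irrefl)
qed

text \<open>Multiplication by a series with constant term \<open>1\<close> changes only monomials of higher degree than
  the least one. This gives the invariance of the Magnus order under translations.\<close>

lemma least_monomial_conv_left:
  assumes "least_monomial f m" "k [] = 1"
  shows "least_monomial (conv k f) m" "conv k f m = f m"
proof -
  have f: "f u \<noteq> 0 \<Longrightarrow> u = m \<or> (m, u) \<in> L" for u using assms(1) by (simp add: least_monomial_def)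
  have short: "f u = 0" if "length u < length m" for u
    using f[of u] that lenlex_length[of m u "r - Id"] by auto
  have "conv k f m = (\<Sum>i\<in>{0}. k (take i m) * f (drop i m))"
    unfolding conv_def by (rule sum.mono_neutral_right) (auto intro!: short)
  then show eq: "conv k f m = f m" using assms(2) by simp
  have "u = m \<or> (m, u) \<in> L" if nz: "conv k f u \<noteq> 0" for u
  proof -
    obtain i where i: "i \<le> length u" "f (drop i u) \<noteq> 0" using nz by (rule conv_nonzeroE)
    show ?thesis
    proof (cases "i = 0")
      case False
      then have "length m < length u" using short[of "drop i u"] i by fastforce
      then show ?thesis by (simp add: L_length)
    qed (use f i in auto)
  qed
  then show "least_monomial (conv k f) m"
    using assms(1) by (auto simp: least_monomial_def eq)
qed

lemma least_monomial_conv_right: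
  assumes "least_monomial f m" "k [] = 1"
  shows "least_monomial (conv f k) m" "conv f k m = f m"
proof -
  have f: "f u \<noteq> 0 \<Longrightarrow> u = m \<or> (m, u) \<in> L" for u using assms(1) by (simp add: least_monomial_def)
  have short: "f u = 0" if "length u < length m" for u
    using f[of u] that lenlex_length[of m u "r - Id"] by auto
  have "conv f k m = (\<Sum>i\<in>{length m}. f (take i m) * k (drop i m))"
    unfolding conv_def by (rule sum.mono_neutral_right) (auto intro!: short)
  then show eq: "conv f k m = f m" using assms(2) by simp
  have "u = m \<or> (m, u) \<in> L" if nz: "conv f k u \<noteq> 0" for u
  proof -
    obtain i where i: "i \<le> length u" "f (take i u) \<noteq> 0" using nz by (rule conv_nonzeroE)
    show ?thesis
    proof (cases "i = length u")
      case False
      then have "length m < length u" using short[of "take i u"] i by fastforce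
      then show ?thesis by (simp add: L_length)
    qed (use f i in auto)
  qed
  then show "least_monomial (conv f k) m"
    using assms(1) by (auto simp: least_monomial_def eq)
qed

lemma magnus_less_mult:
  assumes car: "g \<in> carrier G" "h \<in> carrier G" "k \<in> carrier G" and less: "magnus_less X r g h"
  shows "magnus_less X r (g \<otimes>\<^bsub>G\<^esub> k) (h \<otimes>\<^bsub>G\<^esub> k)" "magnus_less X r (k \<otimes>\<^bsub>G\<^esub> g) (k \<otimes>\<^bsub>G\<^esub> h)"
proof -
  have k: "magnus X k [] = 1" using car(3) by (simp add: free_group_carrier magnus_at_Nil)
  obtain m where m: "least_monomial (magnus_diff g h) m" "magnus_diff g h m > 0" using less magnus_less_iff by blast
  have "magnus_diff (g \<otimes>\<^bsub>G\<^esub> k) (h \<otimes>\<^bsub>G\<^esub> k) = conv (magnus_diff g h) (magnus X k)"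
    "magnus_diff (k \<otimes>\<^bsub>G\<^esub> g) (k \<otimes>\<^bsub>G\<^esub> h) = conv (magnus X k) (magnus_diff g h)"
    using car by (auto simp: magnus_diff_def magnus_mult conv_diff_left conv_diff_right)
  then show "magnus_less X r (g \<otimes>\<^bsub>G\<^esub> k) (h \<otimes>\<^bsub>G\<^esub> k)" "magnus_less X r (k \<otimes>\<^bsub>G\<^esub> g) (k \<otimes>\<^bsub>G\<^esub> h)"
    using least_monomial_conv_left[of _ _ "magnus X k", OF m(1) k]
      least_monomial_conv_right[of _ _ "magnus X k", OF m(1) k] m(2)
    unfolding magnus_less_iff by metis+
qed

sublocale ordered_group G "magnus_order X r"
proof
  show "linear_order_on (carrier G) (magnus_order X r)"
    unfolding order_on_defs
  proof (intro conjI)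
    show "trans (magnus_order X r)"
      using magnus_less_trans by (auto simp: trans_def magnus_order_def)
    show "antisym (magnus_order X r)"
      using magnus_less_asym by (auto simp: antisym_def magnus_order_def)
    show "total_on (carrier G) (magnus_order X r)"
      using magnus_less_linear by (auto simp: total_on_def magnus_order_def)
  qed (auto simp: magnus_order_def refl_on_def)
qed (auto simp: magnus_order_def magnus_less_mult)

text \<open>Some positive power of \<open>g\<close> is a power of \<open>z\<close> and hence commutes with
  \<open>h\<close>; in an ordered group then \<open>g\<close> itself commutes with \<open>h\<close>.\<close>

lemma centralizers_abelian:
  assumes z: "z \<in> carrier G" "z \<noteq> \<one>\<^bsub>G\<^esub>" and gh: "g \<in> F.cent z" "h \<in> F.cent z"
  shows "g \<otimes>\<^bsub>G\<^esub> h = h \<otimes>\<^bsub>G\<^esub> g"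
proof -
  have g: "g \<in> carrier G" "z \<otimes>\<^bsub>G\<^esub> g = g \<otimes>\<^bsub>G\<^esub> z" and h: "h \<in> carrier G" "h \<otimes>\<^bsub>G\<^esub> z = z \<otimes>\<^bsub>G\<^esub> h"
    using gh by (auto simp: F.cent_def)
  obtain m n where mn: "m > 0" "g [^]\<^bsub>G\<^esub> (m::nat) = z [^]\<^bsub>G\<^esub> (n::nat) \<or> g [^]\<^bsub>G\<^esub> m = (inv\<^bsub>G\<^esub> z) [^]\<^bsub>G\<^esub> n"
    using commuting_elements_have_common_power[OF z(1) _ g] z(2) by (auto simp: free_group_one)
  have C: "subgroup (F.cent h) G" using h(1) by (rule F.subgroup_cent)
  have zC: "z \<in> F.cent h" using z h by (simp add: F.cent_def)
  have pow: "u [^]\<^bsub>G\<^esub> (n::nat) \<in> F.cent h" if "u \<in> F.cent h" for u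
    using F.subgroup_int_pow_closed[OF C that, of "int n"] by (simp add: int_pow_int)
  have "g [^]\<^bsub>G\<^esub> m \<in> F.cent h"
    using mn(2) pow[OF zC] pow[OF subgroup.m_inv_closed[OF C zC]] by auto
  then have "h \<otimes>\<^bsub>G\<^esub> g [^]\<^bsub>G\<^esub> m = g [^]\<^bsub>G\<^esub> m \<otimes>\<^bsub>G\<^esub> h" by (simp add: F.cent_def)
  then show ?thesis using commute_if_pow_commutes[OF h(1) g(1) mn(1)] by simp
qed

text \<open>A positive power \<open>m\<close> of the conjugate \<open>y\<close> is a power of \<open>z\<close>. Let
  \<open>u\<close> be a monomial of least degree in the expansion of \<open>z\<close> minus \<open>1\<close>.
  The coefficient at \<open>u\<close> is additive and invariant under conjugation, so the two exponents agree.
  Hence \<open>y\<^sup>m = z\<^sup>m\<close>, and the order gives \<open>y = z\<close>.\<close>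

lemma conjugates_commute_only_if_equal:
  assumes z: "z \<in> carrier G" and h: "h \<in> carrier G"
    and comm: "h \<otimes>\<^bsub>G\<^esub> z \<otimes>\<^bsub>G\<^esub> inv\<^bsub>G\<^esub> h \<in> F.cent z"
  shows "h \<in> F.cent z"
proof (cases "z = \<one>\<^bsub>G\<^esub>")
  case True then show ?thesis using h by (simp add: F.cent_def)
next
  case False
  let ?y = "h \<otimes>\<^bsub>G\<^esub> z \<otimes>\<^bsub>G\<^esub> inv\<^bsub>G\<^esub> h"
  have "z \<noteq> []" using False by (simp add: free_group_one)
  have y: "?y \<in> carrier G" "z \<otimes>\<^bsub>G\<^esub> ?y = ?y \<otimes>\<^bsub>G\<^esub> z" using comm by (auto simp: F.cent_def)
  obtain m n where mn: "m > 0"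
    and pow: "?y [^]\<^bsub>G\<^esub> (m::nat) = z [^]\<^bsub>G\<^esub> (n::nat) \<or> ?y [^]\<^bsub>G\<^esub> m = (inv\<^bsub>G\<^esub> z) [^]\<^bsub>G\<^esub> n"
    using commuting_elements_have_common_power[OF z \<open>z \<noteq> []\<close> y] .
  have M1: "magnus X g [] = 1" if "g \<in> carrier G" for g
    using that by (simp add: free_group_carrier magnus_at_Nil)
  have "\<exists>u. u \<noteq> [] \<and> magnus X z u \<noteq> 0"
  proof (rule ccontr)
    assume "\<not> ?thesis"
    then have "magnus X z = one_series" using M1[OF z] by (auto simp: one_series_def fun_eq_iff)
    then show False using magnus_kernel[OF z] \<open>z \<noteq> []\<close> by blast
  qed
  then obtain u where u: "u \<noteq> []" "magnus X z u \<noteq> 0"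
    and min: "\<And>v. v \<noteq> [] \<Longrightarrow> magnus X z v \<noteq> 0 \<Longrightarrow> length u \<le> length v"
    using arg_min_nat_lemma[of "\<lambda>u. u \<noteq> [] \<and> magnus X z u \<noteq> 0" _ length] by blast
  \<comment> \<open>The normal subgroup of elements whose expansion minus \<open>1\<close> has degree at least that of \<open>u\<close>.\<close>
  define low where "low g \<longleftrightarrow> g \<in> carrier G \<and> (\<forall>v. v \<noteq> [] \<longrightarrow> length v < length u \<longrightarrow> magnus X g v = 0)" for g
  have low_mult: "magnus X (g \<otimes>\<^bsub>G\<^esub> k) v = magnus X g v + magnus X k v"
    "magnus X (k \<otimes>\<^bsub>G\<^esub> g) v = magnus X g v + magnus X k v"
    if "low g" "k \<in> carrier G" "v \<noteq> []" "length v \<le> length u" for g k v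
    using conv_at_short[of "magnus X g" "length u" "magnus X k" v] that M1
    by (auto simp: low_def magnus_mult)
  have low_z: "low z" using z min by (auto simp: low_def not_le[symmetric])
  have inv_z: "magnus X (inv\<^bsub>G\<^esub> z) v = - magnus X z v" if "v \<noteq> []" "length v \<le> length u" for v
    using low_mult(1)[OF low_z _ that, of "inv\<^bsub>G\<^esub> z"] z that
    by (simp add: free_group_one magnus_Nil one_series_def)
  have low_inv: "low (inv\<^bsub>G\<^esub> z)" using low_z inv_z z by (auto simp: low_def)
  have low_pow: "low (g [^]\<^bsub>G\<^esub> k) \<and> magnus X (g [^]\<^bsub>G\<^esub> k) u = int k * magnus X g u" if "low g" for g and k :: nat
  proof (induction k)
    case 0
    show ?case using u(1) by (simp add: low_def) (simp add: free_group_one magnus_Nil one_series_def)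
  next
    case (Suc k)
    have g: "g \<in> carrier G" using that by (simp add: low_def)
    have "magnus X (g [^]\<^bsub>G\<^esub> Suc k) v = magnus X (g [^]\<^bsub>G\<^esub> k) v + magnus X g v"
      if "v \<noteq> []" "length v \<le> length u" for v
      using low_mult(1)[of "g [^]\<^bsub>G\<^esub> k" g v] Suc g that by simp
    then show ?case using Suc that u(1) by (auto simp: low_def algebra_simps)
  qed
  have hz: "?y [^]\<^bsub>G\<^esub> m \<otimes>\<^bsub>G\<^esub> h = h \<otimes>\<^bsub>G\<^esub> z [^]\<^bsub>G\<^esub> m"
    unfolding F.pow_conjugate[OF h z] using h z by (simp add: F.m_assoc)
  have coeff: "magnus X (?y [^]\<^bsub>G\<^esub> m) u = int m * magnus X z u" if "low (?y [^]\<^bsub>G\<^esub> m)"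
  proof -
    have "magnus X (?y [^]\<^bsub>G\<^esub> m) u + magnus X h u = magnus X (z [^]\<^bsub>G\<^esub> m) u + magnus X h u"
      using low_mult(1)[OF that h u(1) order_refl] low_mult(2)[of "z [^]\<^bsub>G\<^esub> m" h u] low_pow[OF low_z, of m] h u(1)
      unfolding hz by simp
    then show ?thesis using low_pow[OF low_z, of m] by simp
  qed
  from pow have "?y [^]\<^bsub>G\<^esub> m = z [^]\<^bsub>G\<^esub> m"
  proof
    assume eq: "?y [^]\<^bsub>G\<^esub> m = z [^]\<^bsub>G\<^esub> n"
    then have "int m * magnus X z u = int n * magnus X z u" by (metis coeff low_pow[OF low_z])
    then show ?thesis using u(2) eq by simp
  next
    assume eq: "?y [^]\<^bsub>G\<^esub> m = (inv\<^bsub>G\<^esub> z) [^]\<^bsub>G\<^esub> n"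
    then have "int m * magnus X z u = - int n * magnus X z u"
      using coeff low_pow[OF low_inv, of n] inv_z[OF u(1) order_refl] by simp
    then have "(int m + int n) * magnus X z u = 0" by (simp add: algebra_simps)
    then have "int m = - int n" using u(2) by simp
    then show ?thesis using mn by simp
  qed
  then have "?y = z" using mn by (rule nat_pow_cancel[OF y(1) z])
  then have "h \<otimes>\<^bsub>G\<^esub> z = z \<otimes>\<^bsub>G\<^esub> h" using F.inv_solve_right'[of z "h \<otimes>\<^bsub>G\<^esub> z" h] z h by simp
  then show ?thesis using h by (simp add: F.cent_def)
qed

end

theorem theorem14:
  fixes X :: "'x set"
    and r :: "'x rel"
    and D :: "('x letter list \<Rightarrow> 'k::field) ring"
    and K :: "('x letter list \<Rightarrow> 'k) set"
  assumes "linear_order_on X r"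
    and "\<exists>x\<in>X. \<exists>y\<in>X. x \<noteq> y"
    and "D = malcev_neumann (free_group X) (magnus_order X r)"
    and "maximal_subfield D K"
  shows "self_invariant D K"
proof -
  interpret M: magnus_ordered X r
    using assms(1) by unfold_locales
  interpret malcev_neumann_ring "free_group X" "magnus_order X r" D
    using assms(3) by unfold_locales
  show ?thesis
    using M.centralizers_abelian M.conjugates_commute_only_if_equal assms(4)
    by (rule maximal_subfield_self_invariant)
qed

end
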